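(* Let $\mathfrak H$ be a Hilbert space, $A$ a nonnegative self-adjoint operator in $\mathfrak H$, and $y\in S$ a weak solution of $y'(t)+Ay(t)=0$ on $[0,\infty)$. Then for every $k\in\mathbb N$ there exists $c_k>0$ such that $$\mathcal E_r(y)\le c_k\,\omega_k\!\left(\tfrac1r,y\right)\quad\text{for all } r>0.$$
   Context: $e^{-At}=\int_0^\infty e^{-\lambda t}dE(\lambda)$ with $E$ the spectral measure of $A$. A weak solution of $y'+Ay=0$ on $\mathbb R_+=[0,\infty)$ is a continuous $y:\mathbb R_+\to\mathfrak H$ with $\int_0^ty(s)ds\in\mathcal D(A)$ and $y(t)=-A\int_0^ty(s)ds+y(0)$ for all $t\ge0$. $S$ is the set of weak solutions; each has the form $y(t)=e^{-At}f$ with unique $f\in\mathfrak H$; $\|y\|_S=\sup_{t\ge0}\|y(t)\|=\|f\|$. $S_0\subset S$ is the set of weak solutions extending to entire $\mathfrak H$-valued functions of exponential type, with type $\sigma(y)=\inf\{\alpha>0:\exists c,\ \|y(z)\|\le ce^{\alpha|z|}\ \forall z\}$. Best approximation: $\mathcal E_r(y)=\inf\{\|y-y_0\|_S: y_0\in S_0,\ \sigma(y_0)\le r\}$. Modulus of smoothness: for $k\in\mathbb N$ and $t>0$, $\omega_k(t,y)=\sup_{0\le h\le t}\sup_{s\ge0}\big\|\sum_{j=0}^k(-1)^{k-j}\binom kj y(s+jh)\big\|$, and $\omega_0(t,y)=\|y\|_S$. *)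

theory Defs
  imports "HOL-Analysis.Analysis"
begin

text \<open>A complex Hilbert space is modelled as a real Hilbert space (class
  real_inner + complete_space) together with a complex structure J
  (multiplication by the imaginary unit), which is real-linear, satisfies
  J (J x) = - x, and is an isometry for the real inner product.
  The real inner product is the real part of the complex one.\<close>

definition complex_structure :: "('a::real_inner \<Rightarrow> 'a) \<Rightarrow> bool" where
  "complex_structure J \<longleftrightarrow> linear J \<and> (\<forall>x. J (J x) = - x)
     \<and> (\<forall>x y. inner (J x) (J y) = inner x y)"

definition cscale :: "('a::real_vector \<Rightarrow> 'a) \<Rightarrow> complex \<Rightarrow> 'a \<Rightarrow> 'a" where
  "cscale J c x = Re c *\<^sub>R x + Im c *\<^sub>R J x"

text \<open>Complex inner product (linear in the first, antilinear in the second argument).\<close>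
definition cinner :: "('a::real_inner \<Rightarrow> 'a) \<Rightarrow> 'a \<Rightarrow> 'a \<Rightarrow> complex" where
  "cinner J x y = Complex (inner x y) (inner x (J y))"

definition linear_operator ::
  "('a::real_inner \<Rightarrow> 'a) \<Rightarrow> 'a set \<Rightarrow> ('a \<Rightarrow> 'a) \<Rightarrow> bool" where
  "linear_operator J D A \<longleftrightarrow> subspace D \<and> (\<forall>x\<in>D. J x \<in> D)
     \<and> (\<forall>x\<in>D. \<forall>y\<in>D. A (x + y) = A x + A y)
     \<and> (\<forall>x\<in>D. \<forall>c. A (cscale J c x) = cscale J c (A x))"

definition adjoint_domain ::
  "('a::real_inner \<Rightarrow> 'a) \<Rightarrow> 'a set \<Rightarrow> ('a \<Rightarrow> 'a) \<Rightarrow> 'a set" where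
  "adjoint_domain J D A = {y. \<exists>z. \<forall>x\<in>D. cinner J (A x) y = cinner J x z}"

text \<open>Self-adjoint: densely defined, symmetric, and D(A*) \<subseteq> D(A) (hence A = A*).\<close>
definition self_adjoint ::
  "('a::real_inner \<Rightarrow> 'a) \<Rightarrow> 'a set \<Rightarrow> ('a \<Rightarrow> 'a) \<Rightarrow> bool" where
  "self_adjoint J D A \<longleftrightarrow> linear_operator J D A \<and> closure D = UNIV
     \<and> (\<forall>x\<in>D. \<forall>y\<in>D. cinner J (A x) y = cinner J x (A y))
     \<and> adjoint_domain J D A \<subseteq> D"

definition nonneg_self_adjoint ::
  "('a::real_inner \<Rightarrow> 'a) \<Rightarrow> 'a set \<Rightarrow> ('a \<Rightarrow> 'a) \<Rightarrow> bool" where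
  "nonneg_self_adjoint J D A \<longleftrightarrow> self_adjoint J D A
     \<and> (\<forall>x\<in>D. 0 \<le> Re (cinner J (A x) x))"

definition weak_solutions ::
  "'a set \<Rightarrow> ('a \<Rightarrow> 'a) \<Rightarrow> (real \<Rightarrow> 'a::{real_inner,complete_space}) set" where
  "weak_solutions D A = {y. continuous_on {0..} y \<and>
     (\<forall>t\<ge>0. integral {0..t} y \<in> D \<and> y t = - A (integral {0..t} y) + y 0)}"

definition S_norm :: "(real \<Rightarrow> 'a::real_normed_vector) \<Rightarrow> real" where
  "S_norm y = (SUP t\<in>{0..}. norm (y t))"

text \<open>Entire 'a-valued functions: complex differentiable everywhere, i.e. real
  differentiable with complex-linear derivative.\<close>
definition entire_fun :: "('a::real_normed_vector \<Rightarrow> 'a) \<Rightarrow> (complex \<Rightarrow> 'a) \<Rightarrow> bool" where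
  "entire_fun J F \<longleftrightarrow> (\<exists>F'. \<forall>z. (F has_derivative (\<lambda>h. cscale J h (F' z))) (at z))"

definition type_exponents :: "(complex \<Rightarrow> 'a::real_normed_vector) \<Rightarrow> real set" where
  "type_exponents F = {\<alpha>. \<alpha> > 0 \<and> (\<exists>c. \<forall>z. norm (F z) \<le> c * exp (\<alpha> * cmod z))}"

text \<open>y0 \<in> S_0 with \<sigma>(y0) \<le> r: y0 is a weak solution extending to an entire function
  of exponential type whose type (the infimum of admissible exponents) is \<le> r.\<close>
definition S0_type_le ::
  "('a \<Rightarrow> 'a) \<Rightarrow> 'a set \<Rightarrow> ('a \<Rightarrow> 'a) \<Rightarrow> real \<Rightarrow> (real \<Rightarrow> 'a::{real_inner,complete_space}) set" where
  "S0_type_le J D A r = {y0. y0 \<in> weak_solutions D A \<and>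
     (\<exists>F. entire_fun J F \<and> (\<forall>t\<ge>0. F (complex_of_real t) = y0 t)
          \<and> type_exponents F \<noteq> {} \<and> Inf (type_exponents F) \<le> r)}"

definition best_approx ::
  "('a \<Rightarrow> 'a) \<Rightarrow> 'a set \<Rightarrow> ('a \<Rightarrow> 'a) \<Rightarrow> real \<Rightarrow> (real \<Rightarrow> 'a::{real_inner,complete_space}) \<Rightarrow> real" where
  "best_approx J D A r y = (INF y0\<in>S0_type_le J D A r. S_norm (\<lambda>t. y t - y0 t))"

text \<open>Modulus of smoothness \<omega>_k(t,y) (for k = 0 it equals S_norm y).\<close>
definition modulus :: "nat \<Rightarrow> real \<Rightarrow> (real \<Rightarrow> 'a::real_normed_vector) \<Rightarrow> real" where
  "modulus k t y = (SUP h\<in>{0..t}. SUP s\<in>{0..}.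
     norm (\<Sum>j=0..k. ((-1) ^ (k - j) * real (k choose j)) *\<^sub>R y (s + real j * h)))"

end

theory Submission
  imports Defs
begin

text \<open>Fix \<open>r > 0\<close>. There is an orthogonal projection \<open>P\<close> commuting with \<open>A\<close> such that \<open>A\<close> is bounded
  by \<open>r\<close> on the range of \<open>P\<close> and bounded below by \<open>r\<close> on its kernel. The solution
  \<open>y\<^sub>0\<close> with initial value \<open>P (y 0)\<close> is the exponential series of \<open>- t A\<close>, hence of
  type at most \<open>r\<close>. The remainder \<open>v = y - P y\<close> is a weak solution in the kernel of \<open>P\<close>, so it
  decays like \<open>exp (- r t)\<close>. Hence one difference with step \<open>1/r\<close> reduces its norm at most by
  the factor \<open>1 - exp (- 1)\<close>, and \<open>k\<close> differences give the constant \<open>(1 - exp (- 1))\<^sup>-\<^sup>k\<close>.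
  Existence of \<open>P\<close> only requires the sign of one bounded operator, not the spectral theorem.\<close>

section \<open>Orthogonal projections\<close>

text \<open>The cut at level \<open>r\<close> is matched to the step \<open>1/r\<close>: the
  solution vanishing under \<open>P\<close> decays over one step by \<open>exp (- (r * h))\<close>
  with \<open>r * h = 1\<close>, so neither \<open>r\<close> nor \<open>y\<close> enters the
  constant. The lower bound on differences already holds for the single step \<open>1/r\<close> and
  the single base point 0; the supremum in the modulus is used only through that one sample.

  The obstacle is that \<open>A\<close> is unbounded, whereas the sign is constructed for
  contractions. The resolvent \<open>B = (1 + A/r)^(-1)\<close> moves the problem to a bounded
  operator: \<open>\<lambda> \<le> r\<close> corresponds to
  \<open>1 / (1 + \<lambda>/r) \<ge> 1/2\<close>, which is why the sign of \<open>B - 1/2\<close> is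
  taken. Spectral inequalities are then replaced by inequalities between quadratic forms. Apart from
  the entire extension, the argument takes place in the underlying real Hilbert space.\<close>

lemma orthogonal_decomposition:
  fixes M :: "'a::{real_inner,complete_space} set"
  assumes "closed M" "subspace M"
  shows "\<exists>m\<in>M. \<forall>z\<in>M. inner (x - m) z = 0"
proof -
  define d where "d = infdist x M"
  have ne: "M \<noteq> {}" using assms(2) subspace_0 by auto
  have d0: "d \<ge> 0" unfolding d_def by (rule infdist_nonneg)
  have lb: "d \<le> norm (x - m)" if "m \<in> M" for m
    using infdist_le[OF that, of x] by (simp add: d_def dist_norm)
  have "\<exists>m\<in>M. norm (x - m) < d + e" if "e > 0" for e
  proof (rule ccontr)
    assume "\<not> ?thesis"
    then have "d + e \<le> infdist x M"
      unfolding infdist_notempty[OF ne] using ne by (intro cINF_greatest) (auto simp: dist_norm not_less)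
    with that show False by (simp add: d_def)
  qed
  then have "\<forall>n. \<exists>m\<in>M. norm (x - m) < d + inverse (real (Suc n))" by simp
  then obtain m where mM: "\<And>n. m n \<in> M"
    and mn: "\<And>n. norm (x - m n) < d + inverse (real (Suc n))" by metis
  have lim: "(\<lambda>n. d + inverse (real (Suc n))) \<longlonglongrightarrow> d"
    using LIMSEQ_inverse_real_of_nat_add by blast
  have "(\<lambda>n. norm (x - m n)) \<longlonglongrightarrow> d"
    by (rule tendsto_sandwich[OF _ _ tendsto_const lim])
      (intro always_eventually allI less_imp_le[OF mn] lb mM)+
  then have sq: "(\<lambda>n. (norm (x - m n))\<^sup>2) \<longlonglongrightarrow> d\<^sup>2" by (intro tendsto_intros)
  \<comment> \<open>Parallelogram law for \<open>x - m i\<close> and \<open>x - m j\<close>: half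
    their sum is \<open>x\<close> minus a midpoint in \<open>M\<close>, so its norm is at least
    \<open>d\<close>. This forces the minimizing sequence to be Cauchy.\<close>
  have par: "(norm (m i - m j))\<^sup>2 \<le> 2 * (norm (x - m i))\<^sup>2 + 2 * (norm (x - m j))\<^sup>2 - 4 * d\<^sup>2" for i j
  proof -
    have "(1/2) *\<^sub>R (m i + m j) \<in> M" by (intro subspace_scale subspace_add assms mM)
    then have "d\<^sup>2 \<le> (norm (x - (1/2) *\<^sub>R (m i + m j)))\<^sup>2"
      using lb d0 by (intro power_mono) auto
    also have "x - (1/2) *\<^sub>R (m i + m j) = (1/2) *\<^sub>R ((x - m i) + (x - m j))"
      by (simp add: algebra_simps flip: scaleR_add_left)
    finally have "4 * d\<^sup>2 \<le> (norm ((x - m i) + (x - m j)))\<^sup>2"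
      by (simp add: power_divide)
    moreover have "(norm ((x - m i) + (x - m j)))\<^sup>2 + (norm ((x - m j) - (x - m i)))\<^sup>2
        = 2 * (norm (x - m i))\<^sup>2 + 2 * (norm (x - m j))\<^sup>2"
      by (simp only: power2_norm_eq_inner inner_add_left inner_add_right inner_diff_left[of "x - m j"]
        inner_diff_right[of _ "x - m j"] inner_commute[of "x - m j" "x - m i"])
    ultimately show ?thesis by simp
  qed
  have "Cauchy m"
  proof (rule metric_CauchyI)
    fix e :: real assume e: "e > 0"
    have "\<forall>\<^sub>F n in sequentially. (norm (x - m n))\<^sup>2 < d\<^sup>2 + e\<^sup>2 / 4"
      using order_tendstoD(2)[OF sq, of "d\<^sup>2 + e\<^sup>2 / 4"] e by simp
    then obtain N where N: "\<And>n. n \<ge> N \<Longrightarrow> (norm (x - m n))\<^sup>2 < d\<^sup>2 + e\<^sup>2 / 4"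
      by (auto simp: eventually_sequentially)
    show "\<exists>N. \<forall>i\<ge>N. \<forall>j\<ge>N. dist (m i) (m j) < e"
    proof (intro exI allI impI)
      fix i j assume "i \<ge> N" "j \<ge> N"
      with par[of i j] N[of i] N[of j] have "(norm (m i - m j))\<^sup>2 < e\<^sup>2" by linarith
      then show "dist (m i) (m j) < e" using e by (simp add: dist_norm power2_less_imp_less)
    qed
  qed
  then obtain l where l: "m \<longlonglongrightarrow> l" using Cauchy_convergent convergent_def by blast
  have lM: "l \<in> M" using assms(1) l mM closed_sequentially by blast
  have "(\<lambda>n. (norm (x - m n))\<^sup>2) \<longlonglongrightarrow> (norm (x - l))\<^sup>2" by (intro tendsto_intros l)
  with sq have dl: "(norm (x - l))\<^sup>2 = d\<^sup>2" using LIMSEQ_unique by blast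
  have "inner (x - l) z = 0" if z: "z \<in> M" for z
  proof (cases "z = 0")
    case False
    \<comment> \<open>The minimizer of the quadratic
      \<open>(norm (x - l - t *\<^sub>R z))\<^sup>2\<close> in \<open>t\<close>; there the squared
      distance drops by \<open>(inner (x - l) z)\<^sup>2 / inner z z\<close>, which minimality of
      \<open>l\<close> forbids unless it is zero.\<close>
    define t where "t = inner (x - l) z / inner z z"
    have zz: "inner z z > 0" using False by simp
    have "l + t *\<^sub>R z \<in> M" by (intro subspace_scale subspace_add assms lM z)
    then have "d\<^sup>2 \<le> (norm (x - (l + t *\<^sub>R z)))\<^sup>2" using lb d0 by (intro power_mono) auto
    then have "(norm (x - l))\<^sup>2 \<le> (norm (x - l - t *\<^sub>R z))\<^sup>2"
      by (simp add: dl diff_diff_eq)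
    also have "\<dots> = (norm (x - l))\<^sup>2 - 2 * t * inner (x - l) z + t\<^sup>2 * inner z z"
      by (simp only: power2_norm_eq_inner power2_eq_square[of t] inner_diff_left[of _ "t *\<^sub>R z"]
        inner_diff_right[of _ _ "t *\<^sub>R z"] inner_commute[of z "x - l"]
        inner_scaleR_left inner_scaleR_right) (simp add: algebra_simps)
    also have "\<dots> = (norm (x - l))\<^sup>2 - (inner (x - l) z)\<^sup>2 / inner z z"
      using zz by (simp add: t_def power2_eq_square field_simps)
    finally have "(inner (x - l) z)\<^sup>2 / inner z z \<le> 0" by simp
    then show ?thesis using zz by (simp add: divide_le_0_iff)
  qed simp
  with lM show ?thesis by blast
qed

text \<open>Membership of \<open>m\<close> in \<open>M\<close> and orthogonality of
  \<open>x - m\<close> to \<open>M\<close> determine \<open>m\<close>, so linearity of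
  \<open>P\<close> reduces to checking both for sums and multiples. Pythagoras bounds
  \<open>P\<close> and its complement by 1.\<close>

lemma orthogonal_projection:
  fixes M :: "'a::{real_inner,complete_space} set"
  assumes "closed M" "subspace M"
  obtains P where "bounded_linear P" "\<And>x. P x \<in> M" "\<And>x. x \<in> M \<Longrightarrow> P x = x"
    "\<And>x z. z \<in> M \<Longrightarrow> inner (x - P x) z = 0" "\<And>x. norm (P x) \<le> norm x"
    "\<And>x. norm (x - P x) \<le> norm x"
proof -
  obtain P where PM: "\<And>x. P x \<in> M" and orth: "\<And>x z. z \<in> M \<Longrightarrow> inner (x - P x) z = 0"
    using orthogonal_decomposition[OF assms] by metis
  have unique: "P x = m" if m: "m \<in> M" "\<And>z. z \<in> M \<Longrightarrow> inner (x - m) z = 0" for x m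
  proof -
    have "P x - m \<in> M" using m PM assms(2) by (auto intro: subspace_diff)
    then have "inner (x - m) (P x - m) = 0" "inner (x - P x) (P x - m) = 0"
      using m orth by blast+
    then have "inner (P x - m) (P x - m) = 0" by (simp add: inner_simps)
    then show ?thesis by simp
  qed
  have pyth: "(norm x)\<^sup>2 = (norm (P x))\<^sup>2 + (norm (x - P x))\<^sup>2" for x
    using norm_add_Pythagorean[of "x - P x" "P x"] orth[OF PM, of x x] by (simp add: orthogonal_def)
  have nP: "norm (P x) \<le> norm x" "norm (x - P x) \<le> norm x" for x
    by (rule power2_le_imp_le; use pyth[of x] in simp)+
  have add: "P (x + y) = P x + P y" for x y
  proof (rule unique)
    show "P x + P y \<in> M" using PM assms(2) by (auto intro: subspace_add)
    show "inner (x + y - (P x + P y)) z = 0" if "z \<in> M" for z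
      using orth[OF that, of x] orth[OF that, of y] by (simp add: inner_simps)
  qed
  have scale: "P (c *\<^sub>R x) = c *\<^sub>R P x" for c x
  proof (rule unique)
    show "c *\<^sub>R P x \<in> M" using PM assms(2) by (auto intro: subspace_scale)
    show "inner (c *\<^sub>R x - c *\<^sub>R P x) z = 0" if "z \<in> M" for z
      using orth[OF that, of x] by (simp add: inner_simps)
  qed
  have "bounded_linear P"
    by (rule bounded_linear_intro[of _ 1]) (use add scale nP in auto)
  moreover have "P x = x" if "x \<in> M" for x using that by (intro unique) auto
  ultimately show thesis using that PM orth nP by blast
qed

section \<open>Calculus in Hilbert space\<close>

text \<open>The sort \<open>{real_inner, complete_space}\<close> is not a subsort of \<open>banach\<close>, so the calculus
  lemmas of the library do not apply directly. They are transported along the Riesz isomorphism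
  from the dual space, whose type does belong to the class \<open>banach\<close>.\<close>

lemma riesz_isomorphism:
  obtains \<Phi> :: "'a::{real_inner,complete_space} \<Rightarrow> ('a \<Rightarrow>\<^sub>L real)" and \<Psi>
  where "bounded_linear \<Phi>" "bounded_linear \<Psi>" "\<And>x. \<Psi> (\<Phi> x) = x" "\<And>l. \<Phi> (\<Psi> l) = l"
    "\<And>x. norm (\<Phi> x) = norm x"
proof -
  define \<Phi> where "\<Phi> = (\<lambda>x::'a. blinfun_inner_left x)"
  have app: "\<Phi> x y = inner x y" for x y
    by (simp add: \<Phi>_def inner_commute)
  have nrm: "norm (\<Phi> x) = norm x" for x
  proof (rule antisym)
    show "norm (\<Phi> x) \<le> norm x"
      by (rule norm_blinfun_bound) (auto simp: app Cauchy_Schwarz_ineq2)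
    have "norm x * norm x \<le> norm (\<Phi> x) * norm x"
      using norm_blinfun[of "\<Phi> x" x] by (simp add: app norm_eq_sqrt_inner)
    then show "norm x \<le> norm (\<Phi> x)" by (cases "x = 0") auto
  qed
  have lin: "\<Phi> (x + y) = \<Phi> x + \<Phi> y" "\<Phi> (c *\<^sub>R x) = c *\<^sub>R \<Phi> x" for x y c
    by (rule blinfun_eqI; simp add: app blinfun.bilinear_simps inner_simps)+
  have bl: "bounded_linear \<Phi>"
    by (rule bounded_linear_intro[of _ 1]) (simp_all add: lin nrm)
  have surj: "\<exists>x. \<Phi> x = l" for l
  proof (cases "l = 0")
    case True
    then show ?thesis using nrm[of 0] by (intro exI[of _ 0]) simp
  next
    case False
    define M where "M = {x. blinfun_apply l x = 0}"
    have M: "closed M" "subspace M"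
      unfolding M_def
      by (auto intro!: closed_Collect_eq continuous_intros subspaceI simp: blinfun.bilinear_simps)
    obtain u where u: "l u \<noteq> 0" using False by (metis blinfun_eqI zero_blinfun.rep_eq)
    obtain m where m: "m \<in> M" "\<And>z. z \<in> M \<Longrightarrow> inner (u - m) z = 0"
      using orthogonal_decomposition[OF M] by metis
    \<comment> \<open>\<open>w\<close> is orthogonal to the kernel of \<open>l\<close>, and
      \<open>y - (l y / l w) *\<^sub>R w\<close> lies in that kernel, so \<open>l\<close> is a
      multiple of \<open>inner w\<close>; evaluation at \<open>w\<close> gives the
      coefficient.\<close>
    define w where "w = u - m"
    have lw: "l w \<noteq> 0" using u m by (simp add: w_def M_def blinfun.bilinear_simps)
    then have w0: "inner w w \<noteq> 0" by (auto simp: blinfun.bilinear_simps)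
    have "\<Phi> ((l w / inner w w) *\<^sub>R w) = l"
    proof (rule blinfun_eqI)
      fix y
      have "y - (l y / l w) *\<^sub>R w \<in> M" using lw by (simp add: M_def blinfun.bilinear_simps)
      then have "inner w (y - (l y / l w) *\<^sub>R w) = 0" using m(2) unfolding w_def by blast
      then have "inner w y = (l y / l w) * inner w w" by (simp add: inner_simps)
      then show "\<Phi> ((l w / inner w w) *\<^sub>R w) y = l y"
        using lw w0 by (simp add: app)
    qed
    then show ?thesis ..
  qed
  have inj: "x = y" if "\<Phi> x = \<Phi> y" for x y
    using nrm[of "x - y"] that bl by (simp add: linear_diff bounded_linear.linear)
  obtain \<Psi> where \<Psi>: "\<And>l. \<Phi> (\<Psi> l) = l" using surj by metis
  have \<Psi>\<Phi>: "\<Psi> (\<Phi> x) = x" for x using inj \<Psi> by blast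
  have "bounded_linear \<Psi>"
  proof (rule bounded_linear_intro[of _ 1])
    show "\<Psi> (x + y) = \<Psi> x + \<Psi> y" for x y by (rule inj) (simp add: \<Psi> lin)
    show "\<Psi> (c *\<^sub>R x) = c *\<^sub>R \<Psi> x" for x c by (rule inj) (simp add: \<Psi> lin)
    show "norm (\<Psi> x) \<le> norm x * 1" for x using nrm[of "\<Psi> x"] by (simp add: \<Psi>)
  qed
  with bl show thesis using that \<Psi> \<Psi>\<Phi> nrm by blast
qed

lemma hilbert_integrable_continuous:
  fixes f :: "real \<Rightarrow> 'a::{real_inner,complete_space}"
  assumes "continuous_on {a..b} f"
  shows "f integrable_on {a..b}"
proof -
  obtain \<Phi> :: "'a \<Rightarrow> ('a \<Rightarrow>\<^sub>L real)" and \<Psi>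
    where r: "bounded_linear \<Phi>" "bounded_linear \<Psi>" "\<And>x. \<Psi> (\<Phi> x) = x"
    by (rule riesz_isomorphism) blast
  have "continuous_on {a..b} (\<lambda>s. \<Phi> (f s))"
    using assms r(1) by (rule bounded_linear.continuous_on[rotated])
  then have "(\<lambda>s. \<Phi> (f s)) integrable_on {a..b}" by (rule integrable_continuous_real)
  from integrable_linear[OF this r(2)] show ?thesis by (simp add: o_def r(3))
qed

lemma hilbert_integral_has_vector_derivative:
  fixes f :: "real \<Rightarrow> 'a::{real_inner,complete_space}"
  assumes "continuous_on {a..b} f" "t \<in> {a..b}"
  shows "((\<lambda>u. integral {a..u} f) has_vector_derivative f t) (at t within {a..b})"
proof -
  obtain \<Phi> :: "'a \<Rightarrow> ('a \<Rightarrow>\<^sub>L real)" and \<Psi>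
    where r: "bounded_linear \<Phi>" "bounded_linear \<Psi>" "\<And>x. \<Psi> (\<Phi> x) = x"
    by (rule riesz_isomorphism) blast
  have c: "continuous_on {a..b} (\<lambda>s. \<Phi> (f s))"
    using assms(1) r(1) by (rule bounded_linear.continuous_on[rotated])
  have "((\<lambda>u. \<Psi> (integral {a..u} (\<lambda>s. \<Phi> (f s)))) has_vector_derivative \<Psi> (\<Phi> (f t))) (at t within {a..b})"
    by (rule bounded_linear.has_vector_derivative[OF r(2) integral_has_vector_derivative[OF c assms(2)]])
  moreover have "\<Psi> (integral {a..u} (\<lambda>s. \<Phi> (f s))) = integral {a..u} f" if "u \<in> {a..b}" for u
  proof -
    have "(\<lambda>s. \<Phi> (f s)) integrable_on {a..u}"
      using c that by (intro integrable_continuous_real) (auto elim: continuous_on_subset)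
    from integral_linear[OF this r(2)] show ?thesis by (simp add: o_def r(3))
  qed
  ultimately show ?thesis
    using assms(2) by (auto simp: r(3) elim: has_vector_derivative_transform[rotated -1])
qed

lemma hilbert_fundamental_theorem_of_calculus:
  fixes f :: "real \<Rightarrow> 'a::{real_inner,complete_space}"
  assumes "a \<le> b" "\<And>x. x \<in> {a..b} \<Longrightarrow> (f has_vector_derivative f' x) (at x within {a..b})"
  shows "(f' has_integral (f b - f a)) {a..b}"
proof -
  obtain \<Phi> :: "'a \<Rightarrow> ('a \<Rightarrow>\<^sub>L real)" and \<Psi>
    where r: "bounded_linear \<Phi>" "bounded_linear \<Psi>" "\<And>x. \<Psi> (\<Phi> x) = x"
    by (rule riesz_isomorphism) blast
  have "((\<lambda>x. \<Phi> (f' x)) has_integral (\<Phi> (f b) - \<Phi> (f a))) {a..b}"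
    by (intro fundamental_theorem_of_calculus assms bounded_linear.has_vector_derivative[OF r(1)])
  from has_integral_linear[OF this r(2)] show ?thesis
    by (simp add: o_def r(3) linear_diff bounded_linear.linear[OF r(2)])
qed

lemma hilbert_summable_norm_cancel:
  fixes f :: "nat \<Rightarrow> 'a::{real_inner,complete_space}"
  assumes "summable (\<lambda>n. norm (f n))"
  shows "summable f"
proof -
  obtain \<Phi> :: "'a \<Rightarrow> ('a \<Rightarrow>\<^sub>L real)" and \<Psi>
    where r: "bounded_linear \<Phi>" "bounded_linear \<Psi>" "\<And>x. \<Psi> (\<Phi> x) = x" "\<And>x. norm (\<Phi> x) = norm x"
    by (rule riesz_isomorphism) blast
  have "summable (\<lambda>n. \<Phi> (f n))"
    by (rule summable_norm_cancel) (simp add: r(4) assms)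
  from bounded_linear.summable[OF r(2) this] show ?thesis by (simp add: r(3))
qed

lemma hilbert_has_derivative_series:
  fixes f :: "nat \<Rightarrow> 'b::real_normed_vector \<Rightarrow> 'a::{real_inner,complete_space}"
  assumes "convex S"
    and "\<And>n x. x \<in> S \<Longrightarrow> ((f n) has_derivative (f' n x)) (at x within S)"
    and "\<And>e. e > 0 \<Longrightarrow> \<forall>\<^sub>F n in sequentially. \<forall>x\<in>S. \<forall>h. norm (sum (\<lambda>i. f' i x h) {..<n} - g' x h) \<le> e * norm h"
    and "x \<in> S" and "(\<lambda>n. f n x) sums l"
  shows "\<exists>g. \<forall>x\<in>S. (\<lambda>n. f n x) sums (g x) \<and> (g has_derivative g' x) (at x within S)"
proof -
  obtain \<Phi> :: "'a \<Rightarrow> ('a \<Rightarrow>\<^sub>L real)" and \<Psi>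
    where r: "bounded_linear \<Phi>" "bounded_linear \<Psi>" "\<And>x. \<Psi> (\<Phi> x) = x" "\<And>x. norm (\<Phi> x) = norm x"
    by (rule riesz_isomorphism) blast
  \<comment> \<open>\<open>\<Phi>\<close> is a linear isometry, so the uniform convergence of the
    derivatives carries over with the same \<open>e\<close>.\<close>
  have lin: "norm (sum (\<lambda>i. \<Phi> (f' i x h)) {..<n} - \<Phi> (g' x h)) = norm (sum (\<lambda>i. f' i x h) {..<n} - g' x h)"
    for n x h
    by (simp add: r(4) linear_diff linear_sum bounded_linear.linear[OF r(1)] flip: r(4)[of "_ - _"])
  have "\<exists>g. \<forall>x\<in>S. (\<lambda>n. \<Phi> (f n x)) sums (g x) \<and> (g has_derivative (\<lambda>h. \<Phi> (g' x h))) (at x within S)"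
  proof (rule has_derivative_series[OF assms(1) _ _ assms(4)])
    show "((\<lambda>x. \<Phi> (f n x)) has_derivative (\<lambda>h. \<Phi> (f' n x h))) (at x within S)" if "x \<in> S" for n x
      using bounded_linear.has_derivative[OF r(1) assms(2)[OF that]] .
    show "(\<lambda>n. \<Phi> (f n x)) sums \<Phi> l" using bounded_linear.sums[OF r(1) assms(5)] .
  qed (unfold lin, rule assms(3))
  then obtain g where g: "\<And>x. x \<in> S \<Longrightarrow> (\<lambda>n. \<Phi> (f n x)) sums (g x)"
    "\<And>x. x \<in> S \<Longrightarrow> (g has_derivative (\<lambda>h. \<Phi> (g' x h))) (at x within S)" by blast
  show ?thesis
    using bounded_linear.sums[OF r(2) g(1)] bounded_linear.has_derivative[OF r(2) g(2)]
    by (intro exI[of _ "\<lambda>x. \<Psi> (g x)"]) (simp add: r(3))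
qed

section \<open>Square roots and spectral sign projections\<close>

text \<open>Writing \<open>Z = 1 - Q\<close>, the equation \<open>2 Z = X + Z\<^sup>2\<close> says \<open>Q\<^sup>2 = 1 - X\<close>; the solution is
  the limit of the iteration \<open>Z' = (X + Z\<^sup>2) / 2\<close>, which is dominated by the scalar
  iteration \<open>z' = (1 + z\<^sup>2) / 2\<close>.\<close>

lemma operator_square_root:
  fixes X :: "'a::{real_inner,complete_space} \<Rightarrow> 'a"
  assumes linX: "bounded_linear X" and X: "\<And>x. norm (X x) \<le> norm x"
    and saX: "\<And>x y. inner (X x) y = inner x (X y)"
  obtains Z where "bounded_linear Z" "\<And>x. norm (Z x) \<le> norm x" "\<And>x. 2 *\<^sub>R Z x = X x + Z (Z x)"
    "\<And>T x. bounded_linear T \<Longrightarrow> (\<And>x. T (X x) = X (T x)) \<Longrightarrow> T (Z x) = Z (T x)"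
    "\<And>x y. inner (Z x) y = inner x (Z y)"
proof -
  define Zs where "Zs = rec_nat (\<lambda>x. 0 :: 'a) (\<lambda>_ Z x. (1/2) *\<^sub>R (X x + Z (Z x)))"
  define zs where "zs = rec_nat (0 :: real) (\<lambda>_ z. (1/2) * (1 + z * z))"
  have Z0: "\<And>x. Zs 0 x = 0" and ZS: "\<And>n x. Zs (Suc n) x = (1/2) *\<^sub>R (X x + Zs n (Zs n x))"
    by (simp_all add: Zs_def)
  have z0: "zs 0 = 0" and zS: "\<And>n. zs (Suc n) = (1/2) * (1 + zs n * zs n)"
    by (simp_all add: zs_def)
  have zb: "0 \<le> zs n \<and> zs n \<le> 1" for n
  proof (induction n)
    case (Suc n)
    then have "zs n * zs n \<le> 1" by (simp add: mult_le_one)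
    then show ?case by (simp add: zS)
  qed (simp add: z0)
  have lin: "bounded_linear (Zs n)" for n
  proof (induction n)
    case (Suc n)
    have "bounded_linear (\<lambda>x. (1/2) *\<^sub>R (X x + Zs n (Zs n x)))"
      by (intro bounded_linear_add bounded_linear_scaleR_right[THEN bounded_linear_compose] linX
          bounded_linear_compose[OF Suc Suc])
    then show ?case unfolding ZS .
  qed (simp add: Z0[abs_def])
  have nZ: "norm (Zs n x) \<le> zs n * norm x" for n x
  proof (induction n arbitrary: x)
    case (Suc n)
    have "norm (Zs n (Zs n x)) \<le> zs n * (zs n * norm x)"
      using Suc[of "Zs n x"] mult_left_mono[OF Suc[of x], of "zs n"] zb[of n] by linarith
    then have "norm (X x + Zs n (Zs n x)) \<le> norm x + zs n * (zs n * norm x)"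
      by (intro norm_triangle_le add_mono X)
    then show ?case by (simp add: ZS zS distrib_right mult.assoc del: scaleR_add_right)
  qed (simp add: Z0 z0)
  have step: "norm (Zs (Suc n) x - Zs n x) \<le> (zs (Suc n) - zs n) * norm x" for n x
  proof (induction n arbitrary: x)
    case 0
    then show ?case using X[of x] by (simp add: ZS zS Z0 z0)
  next
    case (Suc n)
    let ?a = "Zs (Suc n)" and ?b = "Zs n" and ?d = "zs (Suc n) - zs n"
    have d: "?d \<ge> 0"
      using zero_le_square[of "zs n - 1"] by (simp add: zS algebra_simps)
    \<comment> \<open>The factorization \<open>a^2 - b^2 = a (a - b) + (a - b) b\<close>, ordered so
      that \<open>a\<close> and \<open>b\<close> need not be commuted; the same identity for
      \<open>zs\<close> turns the bounds on the factors into the next scalar increment.\<close>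
    have eq: "Zs (Suc (Suc n)) x - ?a x = (1/2) *\<^sub>R (?a (?a x - ?b x) + (?a (?b x) - ?b (?b x)))"
      using arg_cong2[of _ _ _ _ minus, OF ZS[of "Suc n" x] ZS[of n x]]
      by (simp add: linear_diff[OF bounded_linear.linear[OF lin]] scaleR_add_right scaleR_diff_right)
    have "norm (?a (?a x - ?b x)) \<le> zs (Suc n) * (?d * norm x)"
      using nZ[of "Suc n" "?a x - ?b x"] mult_left_mono[OF Suc[of x], of "zs (Suc n)"] zb[of "Suc n"]
      by linarith
    moreover have "norm (?a (?b x) - ?b (?b x)) \<le> ?d * (zs n * norm x)"
      using Suc[of "?b x"] mult_left_mono[OF nZ[of n x] d] by linarith
    ultimately have "norm (Zs (Suc (Suc n)) x - ?a x)
        \<le> (1/2) * (zs (Suc n) * (?d * norm x) + ?d * (zs n * norm x))"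
      unfolding eq using norm_triangle_ineq[of "?a (?a x - ?b x)" "?a (?b x) - ?b (?b x)"] by simp
    also have "\<dots> = (1/2) * ((zs (Suc n) * zs (Suc n) - zs n * zs n)) * norm x"
      by (simp add: algebra_simps)
    also have "(1/2) * (zs (Suc n) * zs (Suc n) - zs n * zs n) = zs (Suc (Suc n)) - zs (Suc n)"
      by (simp only: zS[of "Suc n"] zS[of n, symmetric]) (simp add: zS[of n] field_simps)
    finally show ?case .
  qed
  have dist: "norm (Zs (n + m) x - Zs n x) \<le> (zs (n + m) - zs n) * norm x" for n m x
  proof (induction m)
    case (Suc m)
    have "norm (Zs (n + Suc m) x - Zs n x)
        \<le> norm (Zs (Suc (n + m)) x - Zs (n + m) x) + norm (Zs (n + m) x - Zs n x)"
      using norm_triangle_ineq[of "Zs (Suc (n + m)) x - Zs (n + m) x" "Zs (n + m) x - Zs n x"] by simp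
    with Suc step[of "n + m" x] show ?case by (simp add: left_diff_distrib)
  qed simp
  have "incseq zs"
  proof (rule incseq_SucI)
    show "zs n \<le> zs (Suc n)" for n
      using zero_le_square[of "zs n - 1"] by (simp add: zS algebra_simps)
  qed
  then have "convergent zs"
    using zb by (metis incseq_convergent convergentI)
  then have zC: "Cauchy zs" by (rule convergent_Cauchy)
  have "convergent (\<lambda>n. Zs n x)" for x
  proof (rule Cauchy_convergent, rule CauchyI')
    fix e :: real assume "e > 0"
    then have "e / (norm x + 1) > 0" by (simp add: add_nonneg_pos)
    then obtain N where N: "\<And>m n. m \<ge> N \<Longrightarrow> n \<ge> N \<Longrightarrow> norm (zs m - zs n) < e / (norm x + 1)"
      using zC CauchyD by blast
    show "\<exists>M. \<forall>m\<ge>M. \<forall>n>m. dist (Zs m x) (Zs n x) < e"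
    proof (intro exI allI impI)
      fix m n assume "m \<ge> N" "m < n"
      then have "zs n - zs m \<le> e / (norm x + 1)" using N[of n m] by (simp add: abs_less_iff)
      moreover have "norm (Zs n x - Zs m x) \<le> (zs n - zs m) * norm x"
        using dist[of m "n - m" x] \<open>m < n\<close> by simp
      ultimately have "norm (Zs n x - Zs m x) \<le> e / (norm x + 1) * norm x"
        using mult_right_mono[of "zs n - zs m" _ "norm x"] order.trans by fastforce
      also have "\<dots> < e / (norm x + 1) * (norm x + 1)"
        using \<open>e / (norm x + 1) > 0\<close> by (intro mult_strict_left_mono) auto
      also have "\<dots> = e" using add_nonneg_pos[OF norm_ge_zero[of x] zero_less_one] by simp
      finally show "dist (Zs m x) (Zs n x) < e" by (simp add: dist_norm norm_minus_commute)
    qed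
  qed
  then obtain Z where Z: "\<And>x. (\<lambda>n. Zs n x) \<longlonglongrightarrow> Z x" unfolding convergent_def by metis
  have nZs: "norm (Zs n x) \<le> norm x" for n x
    using nZ[of n x] mult_right_mono[of "zs n" 1 "norm x"] zb[of n] by simp
  have nZl: "norm (Z x) \<le> norm x" for x
    by (rule Lim_bounded[OF tendsto_norm[OF Z]]) (use nZs in blast)
  have "bounded_linear Z"
  proof (rule bounded_linear_intro[of _ 1])
    show "Z (x + y) = Z x + Z y" for x y
      using LIMSEQ_unique[OF Z[of "x + y"]] tendsto_add[OF Z[of x] Z[of y]]
      by (simp add: linear_add[OF bounded_linear.linear[OF lin]])
    show "Z (c *\<^sub>R x) = c *\<^sub>R Z x" for c x
      using LIMSEQ_unique[OF Z[of "c *\<^sub>R x"]] tendsto_scaleR[OF tendsto_const Z[of x], of c]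
      by (simp add: linear_scale[OF bounded_linear.linear[OF lin]])
  qed (simp add: nZl)
  moreover have "2 *\<^sub>R Z x = X x + Z (Z x)" for x
  proof -
    \<comment> \<open>The index occurs twice in \<open>Zs n (Zs n x)\<close>; the uniform bound
      \<open>nZs\<close> absorbs the outer occurrence.\<close>
    have "(\<lambda>n. Zs n (Zs n x - Z x)) \<longlonglongrightarrow> 0"
    proof (rule Lim_null_comparison)
      show "\<forall>\<^sub>F n in sequentially. norm (Zs n (Zs n x - Z x)) \<le> norm (Zs n x - Z x)"
        using nZs by simp
      show "(\<lambda>n. norm (Zs n x - Z x)) \<longlonglongrightarrow> 0"
        using Z[of x] by (simp add: LIM_zero tendsto_norm_zero)
    qed
    from tendsto_add[OF this Z[of "Z x"]] have "(\<lambda>n. Zs n (Zs n x)) \<longlonglongrightarrow> Z (Z x)"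
      by (simp add: linear_diff[OF bounded_linear.linear[OF lin]])
    then have "(\<lambda>n. X x + Zs n (Zs n x)) \<longlonglongrightarrow> X x + Z (Z x)" by (intro tendsto_intros)
    moreover have "(\<lambda>n. 2 *\<^sub>R Zs (Suc n) x) \<longlonglongrightarrow> 2 *\<^sub>R Z x"
      using LIMSEQ_Suc[OF Z] by (intro tendsto_intros)
    ultimately show ?thesis by (simp add: ZS LIMSEQ_unique)
  qed
  moreover have "T (Z x) = Z (T x)" if T: "bounded_linear T" "\<And>x. T (X x) = X (T x)" for T x
  proof -
    \<comment> \<open>Every iterate is a polynomial in \<open>X\<close>, so whatever commutes with
      \<open>X\<close> commutes with it.\<close>
    have comm: "T (Zs n x) = Zs n (T x)" for n x
      by (induction n arbitrary: x)
        (simp_all add: Z0 ZS T(2) linear_0 linear_add linear_scale bounded_linear.linear[OF T(1)])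
    show ?thesis
    proof (rule LIMSEQ_unique[OF _ Z])
      show "(\<lambda>n. Zs n (T x)) \<longlonglongrightarrow> T (Z x)"
        using bounded_linear.tendsto[OF T(1) Z[of x]] by (simp add: comm)
    qed
  qed
  moreover have "inner (Z x) y = inner x (Z y)" for x y
  proof -
    have "inner (Zs n x) y = inner x (Zs n y)" for n x y
      by (induction n arbitrary: x y) (simp_all add: Z0 ZS inner_simps saX)
    moreover have "(\<lambda>n. inner (Zs n x) y) \<longlonglongrightarrow> inner (Z x) y" "(\<lambda>n. inner x (Zs n y)) \<longlonglongrightarrow> inner x (Z y)"
      by (intro tendsto_intros Z)+
    ultimately show ?thesis by (simp add: LIMSEQ_unique)
  qed
  ultimately show thesis using that nZl by blast
qed

text \<open>With \<open>Q = (S\<^sup>2)\<^sup>1\<^sup>/\<^sup>2 = |S|\<close>, the projection onto the kernel of \<open>Q - S\<close> separates the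
  nonnegative from the nonpositive spectral part of \<open>S\<close>, because \<open>(Q + S)(Q - S) = 0\<close>.\<close>

lemma spectral_sign_projection:
  fixes S :: "'a::{real_inner,complete_space} \<Rightarrow> 'a"
  assumes linS: "bounded_linear S" and nS: "\<And>x. norm (S x) \<le> norm x"
    and saS: "\<And>x y. inner (S x) y = inner x (S y)"
  obtains P where "bounded_linear P" "\<And>x. P (P x) = P x" "\<And>x. norm (P x) \<le> norm x"
    "\<And>x. norm (x - P x) \<le> norm x"  "\<And>x. S (P x) = P (S x)"
    "\<And>x. P x = x \<Longrightarrow> inner (S x) x \<ge> 0" "\<And>x. P x = 0 \<Longrightarrow> inner (S x) x \<le> 0"
proof -
  note l = linear_0 linear_add linear_diff linear_scale
  note S = l[OF bounded_linear.linear[OF linS]]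
  \<comment> \<open>With this choice \<open>Q = 1 - Z\<close> satisfies
    \<open>Q^2 = 1 - X = S^2\<close>.\<close>
  define X where "X = (\<lambda>x. x - S (S x))"
  have linX: "bounded_linear X"
    unfolding X_def by (intro bounded_linear_sub bounded_linear_ident bounded_linear_compose[OF linS linS])
  have nX: "norm (X x) \<le> norm x" for x
  proof (rule power2_le_imp_le)
    have "inner x (S (S x)) = inner (S x) (S x)" "inner (S (S x)) x = inner (S x) (S x)"
      by (simp_all add: saS)
    then have "(norm (X x))\<^sup>2 = (norm x)\<^sup>2 - 2 * (norm (S x))\<^sup>2 + (norm (S (S x)))\<^sup>2"
      by (simp add: X_def power2_norm_eq_inner inner_diff_left inner_diff_right)
    moreover have "(norm (S (S x)))\<^sup>2 \<le> (norm (S x))\<^sup>2" by (intro power_mono nS) simp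
    ultimately show "(norm (X x))\<^sup>2 \<le> (norm x)\<^sup>2" using zero_le_power2[of "norm (S x)"] by linarith
  qed simp
  have saX: "inner (X x) y = inner x (X y)" for x y
    by (simp add: X_def inner_diff_left inner_diff_right saS)
  obtain Z where linZ: "bounded_linear Z" and nZ: "\<And>x. norm (Z x) \<le> norm x"
    and ZZ: "\<And>x. 2 *\<^sub>R Z x = X x + Z (Z x)"
    and comm: "\<And>T x. bounded_linear T \<Longrightarrow> (\<And>x. T (X x) = X (T x)) \<Longrightarrow> T (Z x) = Z (T x)"
    and saZ: "\<And>x y. inner (Z x) y = inner x (Z y)"
    by (rule operator_square_root[OF linX nX saX]) blast
  have SZ: "S (Z x) = Z (S x)" for x
    by (rule comm[OF linS]) (simp add: X_def S)
  note Z = l[OF bounded_linear.linear[OF linZ]]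
  have Qpos: "inner (x - Z x) x \<ge> 0" for x
    using norm_cauchy_schwarz[of "Z x" x] mult_right_mono[OF nZ[of x], of "norm x"]
    by (simp add: inner_diff_left power2_norm_eq_inner[symmetric] power2_eq_square)
  define K where "K = (\<lambda>x. x - Z x - S x)"
  have linK: "bounded_linear K"
    unfolding K_def by (intro bounded_linear_sub bounded_linear_ident linZ linS)
  note K = l[OF bounded_linear.linear[OF linK]]
  have saK: "inner (K x) y = inner x (K y)" for x y
    by (simp add: K_def inner_diff_left inner_diff_right saS saZ)
  have SK: "S (K x) = K (S x)" for x by (simp add: K_def S SZ)
  \<comment> \<open>In terms of \<open>Q = 1 - Z\<close> and \<open>K = Q - S\<close> this is
    \<open>(Q + S) K = 0\<close>, a consequence of \<open>Q^2 = S^2\<close> and of \<open>S\<close>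
    commuting with \<open>Z\<close>.\<close>
  have QQ: "K x - Z (K x) + S (K x) = 0" for x
    using ZZ[of x] by (simp add: K_def S Z SZ X_def scaleR_2 algebra_simps)
  define M where "M = {x. K x = 0}"
  have M: "closed M" "subspace M"
    unfolding M_def
    by (auto intro!: closed_Collect_eq linear_continuous_on linK continuous_intros subspaceI simp: K)
  obtain P where linP: "bounded_linear P" and PM: "\<And>x. P x \<in> M" and Pid: "\<And>x. x \<in> M \<Longrightarrow> P x = x"
    and orth: "\<And>x z. z \<in> M \<Longrightarrow> inner (x - P x) z = 0"
    and nP: "\<And>x. norm (P x) \<le> norm x" "\<And>x. norm (x - P x) \<le> norm x"
    by (rule orthogonal_projection[OF M]) blast
  note P = l[OF bounded_linear.linear[OF linP]]
  have ker: "P x = 0" if "\<And>z. z \<in> M \<Longrightarrow> inner x z = 0" for x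
  proof -
    have "inner (P x) (P x) = 0" using orth[OF PM[of x], of x] that[OF PM[of x]] by (simp add: inner_diff_left)
    then show ?thesis by simp
  qed
  have SM: "S x \<in> M" if "x \<in> M" for x using that by (simp add: M_def S flip: SK)
  \<comment> \<open>\<open>S\<close> leaves \<open>M\<close> invariant and, being self-adjoint, also
    its orthogonal complement; hence it commutes with the projection.\<close>
  have PS: "S (P x) = P (S x)" for x
  proof -
    have "P (S (x - P x)) = 0" by (rule ker) (simp add: saS orth SM)
    then show ?thesis using Pid[OF SM[OF PM]] by (simp add: S P)
  qed
  have pos: "inner (S x) x \<ge> 0" if "P x = x" for x
  proof -
    have "S x = x - Z x" using PM[of x] that by (simp add: M_def K_def)
    then show ?thesis using Qpos[of x] by simp
  qed
  \<comment> \<open>Here \<open>x\<close> is orthogonal to \<open>M\<close>. The vector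
    \<open>(Q + S) x\<close> lies in \<open>M\<close> because \<open>K\<close> kills it, and is
    orthogonal to \<open>M\<close> because \<open>Q + S\<close> is self-adjoint and acts on
    \<open>M\<close> as \<open>2 S\<close>. So it vanishes, which gives \<open>S x = - Q x\<close>
    with \<open>Q\<close> nonnegative.\<close>
  have neg: "inner (S x) x \<le> 0" if "P x = 0" for x
  proof -
    have "K (x - Z x + S x) = 0" using QQ[of x] by (simp add: K_def S Z SZ algebra_simps)
    then have "x - Z x + S x \<in> M" by (simp add: M_def)
    moreover have "inner y (x - Z x + S x) = 0" if "y \<in> M" for y
    proof -
      have "y - Z y + S y = S y + S y" using \<open>y \<in> M\<close> by (simp add: M_def K_def algebra_simps)
      then have "y - Z y + S y \<in> M" using SM[OF \<open>y \<in> M\<close>] M(2) by (simp add: subspace_add)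
      then have "inner x (y - Z y + S y) = 0" using orth[of _ x] \<open>P x = 0\<close> by simp
      then show ?thesis
        by (simp add: inner_add_left inner_diff_left inner_add_right inner_diff_right inner_commute[of x]
            saS[of y x, symmetric] saZ[of y x, symmetric])
    qed
    ultimately have "inner (x - Z x + S x) (x - Z x + S x) = 0" by blast
    then have "S x + (x - Z x) = 0" by (simp add: add.commute)
    then have "S x = - (x - Z x)" by (rule eq_neg_iff_add_eq_0[THEN iffD2])
    then have "inner (S x) x = - inner (x - Z x) x" by (simp add: inner_minus_left inner_diff_left)
    then show ?thesis using Qpos[of x] by linarith
  qed
  show thesis
    by (rule that[OF linP _ nP PS pos neg]) (use Pid PM in auto)
qed

section \<open>Nonnegative self-adjoint operators\<close>

text \<open>Only the real part of the complex inner product is kept, since the spectral arguments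
  use nothing else; the complex structure returns for the entire extension.\<close>

locale nonneg_operator =
  fixes D :: "'a::{real_inner,complete_space} set" and A :: "'a \<Rightarrow> 'a"
  assumes subspace_D: "subspace D"
    and dense_D: "closure D = UNIV"
    and A_add: "\<lbrakk>x \<in> D; y \<in> D\<rbrakk> \<Longrightarrow> A (x + y) = A x + A y"
    and A_scale: "x \<in> D \<Longrightarrow> A (c *\<^sub>R x) = c *\<^sub>R A x"
    and A_sym: "\<lbrakk>x \<in> D; y \<in> D\<rbrakk> \<Longrightarrow> inner (A x) y = inner x (A y)"
    and A_nonneg: "x \<in> D \<Longrightarrow> 0 \<le> inner (A x) x"
    and adjoint_D: "(\<And>x. x \<in> D \<Longrightarrow> inner (A x) y = inner x z) \<Longrightarrow> y \<in> D"

lemma nonneg_self_adjoint_imp_nonneg_operator: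
  assumes J: "complex_structure J" and A: "nonneg_self_adjoint J D A"
  shows "nonneg_operator D A"
proof -
  have J2: "J (J x) = - x" and JJ: "inner (J x) (J y) = inner x y" and Jlin: "linear J" for x y
    using J by (auto simp: complex_structure_def)
  have J_adj: "inner x (J y) = - inner (J x) y" for x y
    using JJ[of x "J y"] by (simp add: J2)
  have lin: "linear_operator J D A" and cl: "closure D = UNIV"
    and sym: "\<And>x y. x \<in> D \<Longrightarrow> y \<in> D \<Longrightarrow> cinner J (A x) y = cinner J x (A y)"
    and adj: "adjoint_domain J D A \<subseteq> D" and pos: "\<And>x. x \<in> D \<Longrightarrow> 0 \<le> Re (cinner J (A x) x)"
    using A by (auto simp: nonneg_self_adjoint_def self_adjoint_def)
  have AJ: "A (J x) = J (A x)" and JD: "J x \<in> D" if "x \<in> D" for x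
  proof -
    have "A (cscale J \<i> x) = cscale J \<i> (A x)" "J x \<in> D"
      using lin that by (auto simp: linear_operator_def)
    then show "A (J x) = J (A x)" "J x \<in> D" by (simp_all add: cscale_def)
  qed
  show ?thesis
  proof
    show "subspace D" "closure D = UNIV" "\<And>x y. \<lbrakk>x \<in> D; y \<in> D\<rbrakk> \<Longrightarrow> A (x + y) = A x + A y"
      using lin cl by (auto simp: linear_operator_def)
    show "A (c *\<^sub>R x) = c *\<^sub>R A x" if "x \<in> D" for x c
    proof -
      have "A (cscale J (of_real c) x) = cscale J (of_real c) (A x)"
        using lin that by (auto simp: linear_operator_def)
      then show ?thesis by (simp add: cscale_def)
    qed
    show "inner (A x) y = inner x (A y)" if "x \<in> D" "y \<in> D" for x y
      using sym[OF that] by (simp add: cinner_def)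
    show "0 \<le> inner (A x) x" if "x \<in> D" for x
      using pos[OF that] by (simp add: cinner_def)
    show "y \<in> D" if *: "\<And>x. x \<in> D \<Longrightarrow> inner (A x) y = inner x z" for y z
    proof -
      \<comment> \<open>Testing with \<open>J x\<close> recovers the imaginary part, so the real
        adjoint relation implies the complex one.\<close>
      have "cinner J (A x) y = cinner J x z" if "x \<in> D" for x
        using *[OF that] *[OF JD[OF that]] by (simp add: cinner_def J_adj AJ[OF that])
      then show ?thesis using adj by (auto simp: adjoint_domain_def)
    qed
  qed
qed

section \<open>Closedness, resolvent and spectral cutoff\<close>

context nonneg_operator
begin

lemma A_zero: "A 0 = 0"
  using A_scale[OF subspace_0[OF subspace_D], of 0] by simp

lemma A_diff: "\<lbrakk>x \<in> D; y \<in> D\<rbrakk> \<Longrightarrow> A (x - y) = A x - A y"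
  using A_add[of x "(-1) *\<^sub>R y"] A_scale[of y "-1"] subspace_scale[OF subspace_D, of y "-1"] by simp

lemmas D_intros = subspace_add[OF subspace_D] subspace_diff[OF subspace_D]
  subspace_scale[OF subspace_D] subspace_0[OF subspace_D]

lemma orthogonal_D_eq_0:
  assumes "\<And>x. x \<in> D \<Longrightarrow> inner x z = 0"
  shows "z = 0"
proof -
  have "closed {x. inner x z = 0}" by (intro closed_Collect_eq continuous_intros)
  then have "closure D \<subseteq> {x. inner x z = 0}" using assms by (intro closure_minimal) auto
  then have "z \<in> {x. inner x z = 0}" using dense_D by blast
  then show ?thesis by simp
qed

lemma adjoint_eq:
  assumes "\<And>x. x \<in> D \<Longrightarrow> inner (A x) y = inner x z"
  shows "y \<in> D" "A y = z"
proof -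
  show y: "y \<in> D" using assms by (rule adjoint_D)
  have "A y - z = 0"
    by (rule orthogonal_D_eq_0) (use assms A_sym[OF _ y] in \<open>simp add: inner_diff_right\<close>)
  then show "A y = z" by simp
qed

text \<open>An adjoint is always closed: its defining relation, tested on a fixed vector of
  \<open>D\<close>, passes to the limit.\<close>

lemma closed_operator:
  assumes "\<And>n. x n \<in> D" "x \<longlonglongrightarrow> y" "(\<lambda>n. A (x n)) \<longlonglongrightarrow> z"
  shows "y \<in> D" "A y = z"
proof -
  have "inner (A u) y = inner u z" if u: "u \<in> D" for u
  proof (rule LIMSEQ_unique)
    show "(\<lambda>n. inner (A u) (x n)) \<longlonglongrightarrow> inner (A u) y" by (intro tendsto_intros assms)
    show "(\<lambda>n. inner (A u) (x n)) \<longlonglongrightarrow> inner u z"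
      unfolding A_sym[OF u assms(1)] by (intro tendsto_intros assms)
  qed
  then show "y \<in> D" "A y = z" using adjoint_eq by blast+
qed

lemma norm_le_one_plus_A:
  assumes "s > 0" "x \<in> D"
  shows "norm x \<le> norm (x + s *\<^sub>R A x)"
proof (cases "x = 0")
  case False
  have "norm x * norm x \<le> inner (x + s *\<^sub>R A x) x"
    using A_nonneg[OF assms(2)] assms(1) by (simp add: inner_add_left flip: power2_norm_eq_inner power2_eq_square)
  also have "\<dots> \<le> norm (x + s *\<^sub>R A x) * norm x" by (rule norm_cauchy_schwarz)
  finally show ?thesis using False by simp
qed simp

text \<open>\<open>T = 1 + s A\<close> is bounded below by 1 and \<open>A\<close> is closed, so
  \<open>T\<close> is injective with closed range. A vector \<open>w\<close> orthogonal to the range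
  satisfies \<open>A w = - w / s\<close> by self-adjointness, hence \<open>T w = 0\<close> and
  \<open>w = 0\<close>; so the range is the whole space.\<close>

lemma resolvent:
  assumes s: "s > 0"
  obtains B where "bounded_linear B" "\<And>x. B x \<in> D" "\<And>x. B x + s *\<^sub>R A (B x) = x"
    "\<And>x. x \<in> D \<Longrightarrow> B (x + s *\<^sub>R A x) = x" "\<And>x. norm (B x) \<le> norm x"
proof -
  define T where "T = (\<lambda>x. x + s *\<^sub>R A x)"
  have Tadd: "T (x + y) = T x + T y" and Tdiff: "T (x - y) = T x - T y" if "x \<in> D" "y \<in> D" for x y
    using that by (simp_all add: T_def A_add A_diff algebra_simps)
  have Tscale: "T (c *\<^sub>R x) = c *\<^sub>R T x" if "x \<in> D" for x c
    using that by (simp add: T_def A_scale algebra_simps)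
  have Tn: "norm x \<le> norm (T x)" if "x \<in> D" for x
    using norm_le_one_plus_A[OF s that] by (simp add: T_def)
  have inj: "x = y" if "x \<in> D" "y \<in> D" "T x = T y" for x y
    using Tn[of "x - y"] that by (simp add: Tdiff D_intros)
  have sub: "subspace (T ` D)"
  proof (rule subspaceI)
    show "0 \<in> T ` D" by (rule image_eqI[of _ _ 0]) (simp_all add: T_def A_zero D_intros)
    show "x + y \<in> T ` D" if "x \<in> T ` D" "y \<in> T ` D" for x y
      using that by (auto simp: D_intros simp flip: Tadd)
    show "c *\<^sub>R x \<in> T ` D" if "x \<in> T ` D" for x c
      using that by (auto simp: D_intros simp flip: Tscale)
  qed
  have cl: "closed (T ` D)"
    unfolding closed_sequential_limits
  proof (intro allI impI, elim conjE)
    fix u l assume "\<forall>n. u n \<in> T ` D" and l: "u \<longlonglongrightarrow> l"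
    then have "\<forall>n. \<exists>x\<in>D. u n = T x" by blast
    then obtain x where x: "\<And>n. x n \<in> D" "\<And>n. u n = T (x n)" by metis
    have "Cauchy x"
    proof (rule CauchyI)
      fix e :: real assume "e > 0"
      then obtain N where N: "\<And>m n. m \<ge> N \<Longrightarrow> n \<ge> N \<Longrightarrow> norm (u m - u n) < e"
        using LIMSEQ_imp_Cauchy[OF l] CauchyD by blast
      have "norm (x m - x n) \<le> norm (u m - u n)" for m n
        using Tn[of "x m - x n"] by (simp add: x D_intros Tdiff)
      then show "\<exists>M. \<forall>m\<ge>M. \<forall>n\<ge>M. norm (x m - x n) < e" using N le_less_trans by blast
    qed
    then obtain y where y: "x \<longlonglongrightarrow> y" using Cauchy_convergent convergent_def by blast
    have "A (x n) = (1 / s) *\<^sub>R (u n - x n)" for n using s by (simp add: x(2) T_def)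
    moreover have "(\<lambda>n. (1 / s) *\<^sub>R (u n - x n)) \<longlonglongrightarrow> (1 / s) *\<^sub>R (l - y)"
      by (intro tendsto_intros l y)
    ultimately have "(\<lambda>n. A (x n)) \<longlonglongrightarrow> (1 / s) *\<^sub>R (l - y)" by simp
    from closed_operator[OF x(1) y this] have "y \<in> D" "T y = l" using s by (simp_all add: T_def)
    then show "l \<in> T ` D" by blast
  qed
  have surj: "\<exists>x\<in>D. T x = y" for y
  proof -
    obtain m where m: "m \<in> T ` D" "\<And>z. z \<in> T ` D \<Longrightarrow> inner (y - m) z = 0"
      using orthogonal_decomposition[OF cl sub] by metis
    define w where "w = y - m"
    have "inner (A x) w = inner x ((- (1 / s)) *\<^sub>R w)" if "x \<in> D" for x
    proof -
      have "inner w (T x) = 0" using m(2) that w_def by blast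
      then have "inner w x + s * inner w (A x) = 0" by (simp add: T_def inner_add_right)
      then have "inner w (A x) = - (1 / s) * inner w x" using s by (simp add: field_simps)
      then show ?thesis by (simp add: inner_commute)
    qed
    from adjoint_eq[OF this] have "w \<in> D" "A w = (- (1 / s)) *\<^sub>R w" by blast+
    then have "T w = 0" using s by (simp add: T_def)
    then have "w = 0" using Tn[OF \<open>w \<in> D\<close>] by simp
    then show ?thesis using m(1) by (auto simp: w_def)
  qed
  then obtain B where BD: "\<And>x. B x \<in> D" and TB: "\<And>x. T (B x) = x" by metis
  have BT: "B (T x) = x" if "x \<in> D" for x by (rule inj) (simp_all add: BD TB that)
  have nB: "norm (B x) \<le> norm x" for x using Tn[OF BD[of x]] by (simp add: TB)
  have "bounded_linear B"
  proof (rule bounded_linear_intro[of _ 1])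
    show "B (x + y) = B x + B y" for x y by (rule inj) (simp_all add: BD TB Tadd D_intros)
    show "B (c *\<^sub>R x) = c *\<^sub>R B x" for x c by (rule inj) (simp_all add: BD TB Tscale D_intros)
  qed (simp add: nB)
  then show thesis using that BD TB BT nB unfolding T_def by blast
qed

text \<open>A substitute for the spectral projection \<open>E[0,r]\<close>, obtained from the sign of
  \<open>B - 1/2\<close> with \<open>B = (1 + A/r)\<^sup>-\<^sup>1\<close>.\<close>

lemma spectral_cutoff:
  assumes r: "r > 0"
  obtains P where "bounded_linear P" "\<And>x. P (P x) = P x" "\<And>x. norm (P x) \<le> norm x"
    "\<And>x. norm (x - P x) \<le> norm x" "\<And>x. P x \<in> D" "\<And>x. P (A (P x)) = A (P x)"
    "\<And>x. norm (A (P x)) \<le> r * norm (P x)"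
    "\<And>x. x \<in> D \<Longrightarrow> A (P x) = P (A x)"
    "\<And>x. \<lbrakk>x \<in> D; P x = 0\<rbrakk> \<Longrightarrow> r * (norm x)\<^sup>2 \<le> inner (A x) x"
proof -
  define s where "s = 1 / r"
  have s: "s > 0" and rs: "r * s = 1" using r by (simp_all add: s_def)
  obtain B where linB: "bounded_linear B" and BD: "\<And>x. B x \<in> D"
    and TB: "\<And>x. B x + s *\<^sub>R A (B x) = x" and BT: "\<And>x. x \<in> D \<Longrightarrow> B (x + s *\<^sub>R A x) = x"
    and nB: "\<And>x. norm (B x) \<le> norm x"
    using resolvent[OF s] by blast
  note lin = linear_0 linear_add linear_diff linear_scale
  note B = lin[OF bounded_linear.linear[OF linB]]
  have saB: "inner (B x) y = inner x (B y)" for x y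
  proof -
    have "inner (B x) (B y + s *\<^sub>R A (B y)) = inner (B x + s *\<^sub>R A (B x)) (B y)"
      using A_sym[OF BD BD, of x y] by (simp add: inner_add_left inner_add_right)
    then show ?thesis by (simp add: TB)
  qed
  have posB: "inner (B x) x \<ge> 0" for x
  proof -
    have "0 \<le> inner (B x) (B x) + s * inner (B x) (A (B x))"
      using A_nonneg[OF BD[of x]] s by (simp add: inner_commute)
    also have "\<dots> = inner (B x) (B x + s *\<^sub>R A (B x))" by (simp add: inner_add_right)
    finally show ?thesis by (simp add: TB)
  qed
  \<comment> \<open>The outer factor 1/2 leaves the sign of \<open>B - 1/2\<close> unchanged and
    lets the plain triangle inequality show that \<open>S\<close> is a contraction.\<close>
  define S where "S = (\<lambda>x. (1/2) *\<^sub>R (B x - (1/2) *\<^sub>R x))"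
  have linS: "bounded_linear S"
    unfolding S_def
    by (intro bounded_linear_sub linB bounded_linear_scaleR_right[THEN bounded_linear_compose] bounded_linear_ident)
  have nS: "norm (S x) \<le> norm x" for x
  proof -
    have "norm (B x - (1/2) *\<^sub>R x) \<le> norm (B x) + norm x / 2"
      using norm_triangle_ineq4[of "B x" "(1/2) *\<^sub>R x"] by simp
    also have "\<dots> \<le> 2 * norm x" using nB[of x] norm_ge_zero[of x] by linarith
    finally show ?thesis by (simp add: S_def del: scaleR_diff_right)
  qed
  have saS: "inner (S x) y = inner x (S y)" for x y
    by (simp add: S_def inner_diff_left inner_diff_right saB)
  obtain P where linP: "bounded_linear P" and PP: "\<And>x. P (P x) = P x" and nP: "\<And>x. norm (P x) \<le> norm x"
    "\<And>x. norm (x - P x) \<le> norm x" and PS: "\<And>x. S (P x) = P (S x)"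
    and pos: "\<And>x. P x = x \<Longrightarrow> inner (S x) x \<ge> 0" and neg: "\<And>x. P x = 0 \<Longrightarrow> inner (S x) x \<le> 0"
    by (rule spectral_sign_projection[OF linS nS saS]) blast
  note P = lin[OF bounded_linear.linear[OF linP]]
  have PB: "P (B x) = B (P x)" for x
    using PS[of x] by (simp add: S_def P del: scaleR_diff_right)
  have posM: "(norm x)\<^sup>2 \<le> 2 * inner (B x) x" if "P x = x" for x
    using pos[OF that] by (simp add: S_def inner_diff_left power2_norm_eq_inner)
  have negM: "2 * inner (B x) x \<le> (norm x)\<^sup>2" if "P x = 0" for x
    using neg[OF that] by (simp add: S_def inner_diff_left power2_norm_eq_inner)
  define M where "M = {x. P x = x}"
  have M: "subspace M" "closed M"
    unfolding M_def
    by (simp add: subspace_def P)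
      (intro closed_Collect_eq linear_continuous_on linP continuous_on_id)
  have low: "norm x \<le> 2 * norm (B x)" if "x \<in> M" for x
  proof (cases "x = 0")
    case False
    have "(norm x)\<^sup>2 \<le> 2 * inner (B x) x" using posM that by (simp add: M_def)
    also have "\<dots> \<le> 2 * (norm (B x) * norm x)" using norm_cauchy_schwarz[of "B x" x] by simp
    finally have "norm x * norm x \<le> (2 * norm (B x)) * norm x" by (simp add: power2_eq_square)
    then show ?thesis using False by simp
  qed simp
  have subBM: "subspace (B ` M)"
    using linear_subspace_image[OF bounded_linear.linear[OF linB] M(1)] .
  have clBM: "closed (B ` M)"
    unfolding closed_sequential_limits
  proof (intro allI impI, elim conjE)
    fix u l assume "\<forall>n. u n \<in> B ` M" and l: "u \<longlonglongrightarrow> l"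
    then have "\<forall>n. \<exists>x\<in>M. u n = B x" by blast
    then obtain x where x: "\<And>n. x n \<in> M" "\<And>n. u n = B (x n)" by metis
    have "Cauchy x"
    proof (rule CauchyI)
      fix e :: real assume "e > 0"
      then have "e / 2 > 0" by simp
      then obtain N where N: "\<And>m n. m \<ge> N \<Longrightarrow> n \<ge> N \<Longrightarrow> norm (u m - u n) < e / 2"
        using LIMSEQ_imp_Cauchy[OF l] CauchyD by blast
      have le: "norm (x m - x n) \<le> 2 * norm (u m - u n)" for m n
        using low[of "x m - x n"] by (simp add: x B subspace_diff[OF M(1)])
      have "norm (x m - x n) < e" if "m \<ge> N" "n \<ge> N" for m n
        using N[OF that] le[of m n] by simp
      then show "\<exists>M. \<forall>m\<ge>M. \<forall>n\<ge>M. norm (x m - x n) < e" by blast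
    qed
    then obtain y where y: "x \<longlonglongrightarrow> y" using Cauchy_convergent convergent_def by blast
    have "y \<in> M" using M(2) x(1) y closed_sequentially by blast
    moreover have "l = B y"
    proof (rule LIMSEQ_unique[OF l])
      show "u \<longlonglongrightarrow> B y" using bounded_linear.tendsto[OF linB y] by (simp flip: x(2))
    qed
    ultimately show "l \<in> B ` M" by blast
  qed
  \<comment> \<open>Surjectivity of \<open>B\<close> on \<open>M\<close> puts \<open>M\<close>
    inside \<open>D\<close>. The image of \<open>M\<close> is closed because \<open>B\<close> is
    bounded below on \<open>M\<close>; the part of \<open>g\<close> orthogonal to that image is
    orthogonal to its own value under \<open>B\<close>, so \<open>posM\<close> makes it
    zero.\<close>
  have onto: "\<exists>x\<in>M. g = B x" if g: "g \<in> M" for g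
  proof -
    obtain m where m: "m \<in> B ` M" "\<And>z. z \<in> B ` M \<Longrightarrow> inner (g - m) z = 0"
      using orthogonal_decomposition[OF clBM subBM] by metis
    have "m \<in> M" using m(1) by (auto simp: M_def PB)
    then have gm: "g - m \<in> M" using g M(1) by (simp add: subspace_diff)
    then have "inner (B (g - m)) (g - m) = 0" using m(2)[of "B (g - m)"] by (simp add: inner_commute)
    then have "g - m = 0" using posM[of "g - m"] gm by (simp add: M_def)
    then show ?thesis using m(1) by auto
  qed
  have AM: "g \<in> D \<and> P (A g) = A g \<and> norm (A g) \<le> r * norm g" if g: "P g = g" for g
  proof -
    obtain x where x: "P x = x" "g = B x" using onto g by (auto simp: M_def)
    have gD: "g \<in> D" using BD x by simp
    have xg: "x = g + s *\<^sub>R A g" using TB[of x] x by simp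
    then have Ag: "A g = r *\<^sub>R (x - g)" using rs by simp
    \<comment> \<open>With \<open>a = s *\<^sub>R A g\<close>, expanding both sides cancels the
      mixed terms and leaves \<open>norm a \<le> norm g\<close>.\<close>
    have "(norm (g + s *\<^sub>R A g))\<^sup>2 \<le> 2 * inner g (g + s *\<^sub>R A g)"
      using posM[OF x(1)] unfolding x(2)[symmetric] xg[symmetric] .
    moreover have "(norm a)\<^sup>2 \<le> (norm g)\<^sup>2" if "(norm (g + a))\<^sup>2 \<le> 2 * inner g (g + a)" for a
      using that by (simp add: power2_norm_eq_inner inner_add_left inner_add_right inner_commute[of a g])
    ultimately have "(norm (s *\<^sub>R A g))\<^sup>2 \<le> (norm g)\<^sup>2" by blast
    then have "norm (s *\<^sub>R A g) \<le> norm g" by (rule power2_le_imp_le) simp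
    then have "s * norm (A g) \<le> norm g" using s by simp
    then have "r * (s * norm (A g)) \<le> r * norm g" using r by (intro mult_left_mono) auto
    then have "norm (A g) \<le> r * norm g" unfolding mult.assoc[symmetric] rs by simp
    moreover have "P (A g) = A g" unfolding Ag by (simp only: P x(1) g)
    ultimately show ?thesis using gD by blast
  qed
  have comm: "A (P x) = P (A x)" if x: "x \<in> D" for x
  proof -
    have "P x = B (P (x + s *\<^sub>R A x))" using BT[OF x] PB by metis
    then have "P x + s *\<^sub>R A (P x) = P x + s *\<^sub>R P (A x)" using TB[of "P (x + s *\<^sub>R A x)"] by (simp add: P)
    then show ?thesis using s by simp
  qed
  have gap: "r * (norm x)\<^sup>2 \<le> inner (A x) x" if x: "x \<in> D" "P x = 0" for x
  proof -
    \<comment> \<open>As \<open>x = B w\<close>, the claim is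
      \<open>0 \<le> inner x (w - 2 *\<^sub>R x)\<close>, in spectral terms
      \<open>b (1 - 2 b) \<ge> 0\<close>. The identity
      \<open>b (1 - 2 b) = b (1 - 2 b)^2 + 2 b^2 (1 - 2 b)\<close> splits it into positivity of
      \<open>B\<close> at \<open>w - 2 *\<^sub>R x\<close> and \<open>negM\<close> at
      \<open>x\<close>.\<close>
    define w where "w = x + s *\<^sub>R A x"
    have xw: "B w = x" using BT[OF x(1)] by (simp add: w_def)
    have "0 \<le> inner (B (w - 2 *\<^sub>R x)) (w - 2 *\<^sub>R x)" by (rule posB)
    also have "\<dots> = inner x w - 4 * inner x x + 4 * inner (B x) x"
      using saB[of x w] by (simp add: B xw inner_diff_left inner_diff_right)
    also have "\<dots> \<le> inner x w - 2 * (norm x)\<^sup>2" using negM[OF x(2)] by (simp add: power2_norm_eq_inner)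
    also have "\<dots> = s * inner (A x) x - (norm x)\<^sup>2"
      by (simp add: w_def inner_add_right inner_commute power2_norm_eq_inner)
    finally have "r * (norm x)\<^sup>2 \<le> r * (s * inner (A x) x)" using r by simp
    then show ?thesis unfolding mult.assoc[symmetric] rs by simp
  qed
  show thesis
  proof (rule that)
    show "P x \<in> D" "P (A (P x)) = A (P x)" "norm (A (P x)) \<le> r * norm (P x)" for x
      using AM[OF PP[of x]] by blast+
  qed (fact linP PP nP comm gap)+
qed

end

section \<open>Weak solutions\<close>

text \<open>Recovers a solution from its integral. The steps are positive, so the derivative within
  \<open>{0..}\<close> suffices even at \<open>t = 0\<close>, where the initial value has to be
  recovered.\<close>

lemma difference_quotient_tendsto:
  fixes f :: "real \<Rightarrow> 'a::real_normed_vector"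
  assumes f: "(f has_vector_derivative d) (at t within {0..})" and t: "t \<ge> 0"
  shows "(\<lambda>n. real (Suc n) *\<^sub>R (f (t + inverse (real (Suc n))) - f t)) \<longlonglongrightarrow> d"
proof -
  let ?h = "\<lambda>n. inverse (real (Suc n))"
  have "(\<lambda>n. t + ?h n) \<longlonglongrightarrow> t" by (rule LIMSEQ_inverse_real_of_nat_add)
  then have lim: "filterlim (\<lambda>n. t + ?h n) (at t within {0..}) sequentially"
    using t by (auto simp: filterlim_at add_nonneg_nonneg)
  have "((\<lambda>y. norm (f y - f t - (y - t) *\<^sub>R d) / norm (y - t)) \<longlongrightarrow> 0) (at t within {0..})"
    using f unfolding has_vector_derivative_def has_derivative_iff_norm by blast
  from filterlim_compose[OF this lim]
  have "(\<lambda>n. norm (f (t + ?h n) - f t - ?h n *\<^sub>R d) / ?h n) \<longlonglongrightarrow> 0" by simp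
  moreover have "norm (f (t + ?h n) - f t - ?h n *\<^sub>R d) / ?h n
      = norm (real (Suc n) *\<^sub>R (f (t + ?h n) - f t) - d)" for n
  proof -
    have "real (Suc n) *\<^sub>R (f (t + ?h n) - f t - ?h n *\<^sub>R d)
        = real (Suc n) *\<^sub>R (f (t + ?h n) - f t) - (real (Suc n) * ?h n) *\<^sub>R d"
      by (simp only: scaleR_diff_right scaleR_scaleR)
    also have "real (Suc n) * ?h n = 1" by (simp del: of_nat_Suc)
    finally have "real (Suc n) *\<^sub>R (f (t + ?h n) - f t) - d
        = real (Suc n) *\<^sub>R (f (t + ?h n) - f t - ?h n *\<^sub>R d)" by simp
    then show ?thesis by (simp only: norm_scaleR abs_of_nat divide_inverse inverse_inverse_eq mult.commute)
  qed
  ultimately have "(\<lambda>n. norm (real (Suc n) *\<^sub>R (f (t + ?h n) - f t) - d)) \<longlonglongrightarrow> 0" by (simp only:)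
  then show ?thesis using tendsto_norm_zero_iff LIM_zero_iff by blast
qed

lemma integral_from_0_has_vector_derivative:
  fixes y :: "real \<Rightarrow> 'a::{real_inner,complete_space}"
  assumes "continuous_on {0..} y" "t \<ge> 0"
  shows "((\<lambda>t. integral {0..t} y) has_vector_derivative y t) (at t within {0..})"
proof -
  have "((\<lambda>t. integral {0..t} y) has_vector_derivative y t) (at t within {0..t + 1})"
    using assms by (intro hilbert_integral_has_vector_derivative) (auto elim: continuous_on_subset)
  moreover have "at t within {0..t + 1} = at t within {0..}"
    by (rule at_within_nhd[of _ "{..<t + 1}"]) auto
  ultimately show ?thesis by simp
qed

section \<open>Invariance and decay of weak solutions\<close>

context nonneg_operator
begin

lemma weak_solutionI:
  assumes "continuous_on {0..} y" "\<And>t. t \<ge> 0 \<Longrightarrow> integral {0..t} y \<in> D"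
    "\<And>t. t \<ge> 0 \<Longrightarrow> A (integral {0..t} y) = y 0 - y t"
  shows "y \<in> weak_solutions D A"
  using assms by (auto simp: weak_solutions_def)

lemma weak_solutionD:
  assumes "y \<in> weak_solutions D A"
  shows "continuous_on {0..} y" "\<And>t. t \<ge> 0 \<Longrightarrow> integral {0..t} y \<in> D"
    "\<And>t. t \<ge> 0 \<Longrightarrow> A (integral {0..t} y) = y 0 - y t"
    "\<And>t. y integrable_on {0..t}"
proof -
  show c: "continuous_on {0..} y" and "\<And>t. t \<ge> 0 \<Longrightarrow> integral {0..t} y \<in> D"
    using assms by (auto simp: weak_solutions_def)
  show "A (integral {0..t} y) = y 0 - y t" if "t \<ge> 0" for t
  proof -
    have "y t = - A (integral {0..t} y) + y 0"
      using assms that unfolding weak_solutions_def by blast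
    then show ?thesis by (simp add: algebra_simps)
  qed
  show "y integrable_on {0..t}" for t
    by (rule hilbert_integrable_continuous, rule continuous_on_subset[OF c]) auto
qed

lemma weak_solution_diff:
  assumes y: "y \<in> weak_solutions D A" and z: "z \<in> weak_solutions D A"
  shows "(\<lambda>t. y t - z t) \<in> weak_solutions D A"
proof (rule weak_solutionI)
  note y = weak_solutionD[OF y] and z = weak_solutionD[OF z]
  have i: "integral {0..t} (\<lambda>t. y t - z t) = integral {0..t} y - integral {0..t} z" for t
    by (intro integral_diff y z)
  show "continuous_on {0..} (\<lambda>t. y t - z t)" by (intro continuous_intros y z)
  show "integral {0..t} (\<lambda>t. y t - z t) \<in> D" if "t \<ge> 0" for t
    unfolding i by (intro D_intros y z that)
  show "A (integral {0..t} (\<lambda>t. y t - z t)) = y 0 - z 0 - (y t - z t)" if "t \<ge> 0" for t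
    unfolding i using that by (simp add: A_diff y z)
qed

text \<open>The integral of the shifted function is a difference of two values of \<open>I\<close>,
  so the domain condition and the equation follow by linearity.\<close>

lemma weak_solution_shift:
  assumes y: "y \<in> weak_solutions D A" and a: "a \<ge> 0"
  shows "(\<lambda>t. y (t + a)) \<in> weak_solutions D A"
proof (rule weak_solutionI)
  note y = weak_solutionD[OF y]
  define I where "I = (\<lambda>t. integral {0..t} y)"
  have i: "integral {0..t} (\<lambda>s. y (s + a)) = I (t + a) - I a" if t: "t \<ge> 0" for t
  proof -
    have "((\<lambda>s. I (s + a)) has_vector_derivative y (s + a)) (at s within {0..t})" if s: "s \<in> {0..t}" for s
    proof -
      have "(I has_vector_derivative y (s + a)) (at (s + a) within {0..})"
        unfolding I_def using a s by (intro integral_from_0_has_vector_derivative y) auto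
      then have "(I has_vector_derivative y (s + a)) (at (s + a) within (\<lambda>s. s + a) ` {0..t})"
        by (rule has_vector_derivative_within_subset) (use a in auto)
      moreover have "((\<lambda>s. s + a) has_vector_derivative 1) (at s within {0..t})"
        by (auto intro!: derivative_eq_intros)
      ultimately show ?thesis using vector_diff_chain_within by (fastforce simp: o_def)
    qed
    from hilbert_fundamental_theorem_of_calculus[OF t this] show ?thesis
      by (simp add: integral_unique)
  qed
  show "continuous_on {0..} (\<lambda>t. y (t + a))"
    by (rule continuous_on_compose2[OF y(1)]) (use a in \<open>auto intro!: continuous_intros\<close>)
  show "integral {0..t} (\<lambda>s. y (s + a)) \<in> D" if "t \<ge> 0" for t
    unfolding i[OF that] I_def using that a by (intro D_intros y) auto
  show "A (integral {0..t} (\<lambda>s. y (s + a))) = y (0 + a) - y (t + a)" if "t \<ge> 0" for t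
    unfolding i[OF that] I_def using that a by (simp add: A_diff y)
qed

text \<open>A weak solution need not be differentiable, but its moving average
  \<open>W t = \<integral>\<^sub>t\<^sup>t\<^sup>+\<^sup>h y\<close> solves \<open>W' = - A W\<close> in the classical sense, so the energy
  estimate is proved for \<open>W\<close> and passed to the limit \<open>h \<rightarrow> 0\<close>.\<close>

lemma weak_solution_decay:
  assumes y: "y \<in> weak_solutions D A" and t: "t \<ge> 0"
    and coercive: "\<And>a b x. \<lbrakk>0 \<le> a; 0 \<le> b; x = integral {0..b} y - integral {0..a} y\<rbrakk>
      \<Longrightarrow> \<rho> * (norm x)\<^sup>2 \<le> inner (A x) x"
  shows "norm (y t) \<le> exp (- (\<rho> * t)) * norm (y 0)"
proof -
  note y = weak_solutionD[OF y]
  define I where "I = (\<lambda>t. integral {0..t} y)"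
  have I': "(I has_vector_derivative y t) (at t within {0..})" if "t \<ge> 0" for t
    unfolding I_def using integral_from_0_has_vector_derivative[OF y(1) that] .
  have I'': "(I has_vector_derivative y t) (at t)" if "t > 0" for t
  proof -
    have "at t within {0..} = at t" using that by (intro at_within_interior) simp
    then show ?thesis using I'[of t] that by simp
  qed
  have cI: "continuous_on {0..} I"
    using I' by (auto simp: continuous_on_eq_continuous_within intro: has_vector_derivative_continuous)
  have W: "norm (I (t + h) - I t) \<le> exp (- (\<rho> * t)) * norm (I (0 + h) - I 0)" if h: "h > 0" for h
  proof -
    define W where "W = (\<lambda>t. I (t + h) - I t)"
    \<comment> \<open>The derivative of \<open>\<phi>\<close> is \<open>2 exp (2 \<rho> t)\<close>
      times \<open>\<rho> * inner W W - inner (A W) W\<close>, which is nonpositive because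
      \<open>W\<close> is an increment of the integral of \<open>y\<close>, where coercivity is
      assumed.\<close>
    define \<phi> where "\<phi> = (\<lambda>t. exp (2 * \<rho> * t) * inner (W t) (W t))"
    have W': "(W has_vector_derivative (y (t + h) - y t)) (at t)" if "t > 0" for t
    proof -
      have "((I \<circ> (\<lambda>t. t + h)) has_vector_derivative 1 *\<^sub>R y (t + h)) (at t)"
        using that h by (intro vector_diff_chain_at I'') (auto intro!: derivative_eq_intros)
      from has_vector_derivative_diff[OF this I''[OF that]] show ?thesis by (simp add: W_def o_def)
    qed
    have AW: "A (W t) = - (y (t + h) - y t)" if "t \<ge> 0" for t
      using that h by (simp add: W_def I_def A_diff y)
    have "\<phi> t \<le> \<phi> 0"
    \<comment> \<open>At 0 only a one-sided derivative of \<open>I\<close> is at hand, so the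
      derivative is taken on the open interval and continuity covers the endpoints.\<close>
    proof (rule DERIV_nonpos_imp_decreasing_open[OF t])
      fix u :: real assume "0 < u" "u < t"
      have dW: "((\<lambda>t. inner (W t) (W t)) has_real_derivative (- 2 * inner (A (W u)) (W u))) (at u)"
        using bounded_bilinear.has_vector_derivative[OF bounded_bilinear_inner W'[OF \<open>0 < u\<close>] W'[OF \<open>0 < u\<close>]]
          AW[of u] \<open>0 < u\<close>
        by (simp add: has_real_derivative_iff_has_vector_derivative inner_commute inner_diff_right)
      have "(\<phi> has_real_derivative (exp (2 * \<rho> * u) * (2 * \<rho>) * inner (W u) (W u)
          + (- 2 * inner (A (W u)) (W u)) * exp (2 * \<rho> * u))) (at u)"
        unfolding \<phi>_def by (rule DERIV_mult[OF _ dW]) (auto intro!: derivative_eq_intros)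
      moreover have "\<rho> * inner (W u) (W u) \<le> inner (A (W u)) (W u)"
        using coercive[of u "u + h" "W u"] \<open>0 < u\<close> h by (simp add: W_def I_def power2_norm_eq_inner)
      then have "exp (2 * \<rho> * u) * (2 * \<rho>) * inner (W u) (W u)
          + (- 2 * inner (A (W u)) (W u)) * exp (2 * \<rho> * u) \<le> 0"
        using mult_left_mono[of "\<rho> * inner (W u) (W u)" _ "2 * exp (2 * \<rho> * u)"] by (simp add: algebra_simps)
      ultimately show "\<exists>z. (\<phi> has_real_derivative z) (at u) \<and> z \<le> 0" by blast
    next
      have "continuous_on {0..t} W"
        unfolding W_def
        by (intro continuous_on_diff continuous_on_compose2[OF cI] continuous_on_subset[OF cI] continuous_intros)
          (use h in auto)
      then show "continuous_on {0..t} \<phi>" unfolding \<phi>_def by (intro continuous_intros)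
    qed
    then have "(exp (\<rho> * t) * norm (W t))\<^sup>2 \<le> (norm (W 0))\<^sup>2"
      by (simp add: \<phi>_def power_mult_distrib power2_norm_eq_inner mult.assoc flip: exp_double)
    then have "exp (\<rho> * t) * norm (W t) \<le> norm (W 0)" by (rule power2_le_imp_le) simp
    then have "exp (- (\<rho> * t)) * (exp (\<rho> * t) * norm (W t)) \<le> exp (- (\<rho> * t)) * norm (W 0)"
      by (intro mult_left_mono) auto
    then show ?thesis by (simp add: W_def flip: mult.assoc exp_add)
  qed
  define q where "q = (\<lambda>t n. real (Suc n) *\<^sub>R (I (t + inverse (real (Suc n))) - I t))"
  have q: "(\<lambda>n. norm (q t n)) \<longlonglongrightarrow> norm (y t)" if "t \<ge> 0" for t
    unfolding q_def by (rule tendsto_norm[OF difference_quotient_tendsto[OF I'[OF that] that]])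
  show ?thesis
  proof (rule tendsto_le[OF _ tendsto_mult[OF tendsto_const q[of 0]] q[OF t]])
    have "norm (q t n) \<le> exp (- (\<rho> * t)) * norm (q 0 n)" for n
      using mult_left_mono[OF W[of "inverse (real (Suc n))"], of "real (Suc n)"]
      by (simp add: q_def mult.left_commute del: of_nat_Suc)
    then show "\<forall>\<^sub>F n in sequentially. norm (q t n) \<le> exp (- (\<rho> * t)) * norm (q 0 n)" by simp
  qed simp_all
qed

text \<open>Decay at rate 0, with nonnegativity of \<open>A\<close> as coercivity. It places the
  supremum in \<open>S_norm\<close> at time 0.\<close>

lemma weak_solution_norm_le:
  assumes "y \<in> weak_solutions D A" "t \<ge> 0"
  shows "norm (y t) \<le> norm (y 0)"
  using weak_solution_decay[OF assms, of 0] weak_solutionD(2)[OF assms(1)]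
  by (simp add: A_nonneg D_intros)

lemma weak_solution_commute:
  assumes y: "y \<in> weak_solutions D A" and P: "bounded_linear P"
    and PD: "\<And>x. x \<in> D \<Longrightarrow> P x \<in> D" "\<And>x. x \<in> D \<Longrightarrow> A (P x) = P (A x)"
  shows "(\<lambda>t. P (y t)) \<in> weak_solutions D A"
proof (rule weak_solutionI)
  note y = weak_solutionD[OF y]
  have i: "integral {0..t} (\<lambda>t. P (y t)) = P (integral {0..t} y)" for t
    using integral_linear[OF y(4) P] by (simp add: o_def)
  show "continuous_on {0..} (\<lambda>t. P (y t))"
    by (rule bounded_linear.continuous_on[OF P y(1)])
  show "integral {0..t} (\<lambda>t. P (y t)) \<in> D" if "t \<ge> 0" for t
    unfolding i by (intro PD y that)
  show "A (integral {0..t} (\<lambda>t. P (y t))) = P (y 0) - P (y t)" if "t \<ge> 0" for t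
    unfolding i using that by (simp add: PD y linear_diff bounded_linear.linear[OF P])
qed

text \<open>\<open>P\<close> commutes with integration, so increments of the integral of
  \<open>y\<close> stay in the kernel of \<open>P\<close>, where the gap supplies
  coercivity.\<close>

lemma weak_solution_spectral_gap:
  assumes y: "y \<in> weak_solutions D A" and t: "t \<ge> 0"
    and P: "bounded_linear P" "\<And>s. s \<ge> 0 \<Longrightarrow> P (y s) = 0"
    and gap: "\<And>x. \<lbrakk>x \<in> D; P x = 0\<rbrakk> \<Longrightarrow> r * (norm x)\<^sup>2 \<le> inner (A x) x"
  shows "norm (y t) \<le> exp (- (r * t)) * norm (y 0)"
proof (rule weak_solution_decay[OF y t])
  note yD = weak_solutionD[OF y]
  have "P (integral {0..s} y) = 0" for s
  proof -
    have "P (integral {0..s} y) = integral {0..s} (\<lambda>s. P (y s))"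
      using integral_linear[OF yD(4) P(1)] by (simp add: o_def)
    also have "\<dots> = integral {0..s} (\<lambda>s. 0)" by (rule integral_cong) (simp add: P)
    finally show ?thesis by simp
  qed
  then show "r * (norm x)\<^sup>2 \<le> inner (A x) x"
    if "0 \<le> a" "0 \<le> b" "x = integral {0..b} y - integral {0..a} y" for a b x
    using that by (intro gap) (simp_all add: D_intros yD linear_diff bounded_linear.linear[OF P(1)])
qed

end

section \<open>Exponential series\<close>

lemma hilbert_summable_norm_suminf_le:
  fixes f :: "nat \<Rightarrow> 'a::{real_inner,complete_space}"
  assumes "\<And>n. norm (f n) \<le> g n" "summable g"
  shows "summable f" "norm (suminf f) \<le> suminf g"
proof -
  have "summable (\<lambda>n. norm (f n))"
    by (rule summable_comparison_test[OF _ assms(2)]) (use assms(1) in auto)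
  then show f: "summable f" by (rule hilbert_summable_norm_cancel)
  show "norm (suminf f) \<le> suminf g"
  proof (rule LIMSEQ_le[OF tendsto_norm[OF summable_LIMSEQ[OF f]] summable_LIMSEQ[OF assms(2)]])
    show "\<exists>N. \<forall>n\<ge>N. norm (\<Sum>i<n. f i) \<le> (\<Sum>i<n. g i)"
      using assms(1) by (auto intro!: order.trans[OF norm_sum] sum_mono)
  qed
qed

section \<open>Complex scalars and vector-valued power series\<close>

context
  fixes J :: "'a::{real_inner,complete_space} \<Rightarrow> 'a"
  assumes J: "complex_structure J"
begin

lemma norm_cscale: "norm (cscale J c x) = cmod c * norm x"
proof -
  have JJ: "inner (J u) (J v) = inner u v" "J (J u) = - u" for u v
    using J by (auto simp: complex_structure_def)
  \<comment> \<open>An isometry with square -1 is skew, so \<open>x\<close> and \<open>J x\<close>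
    are orthogonal and Pythagoras gives the norm.\<close>
  have "inner x (J x) = 0"
    using JJ(1)[of x "J x"] by (simp add: JJ(2) inner_commute)
  then have "(norm (cscale J c x))\<^sup>2 = ((Re c)\<^sup>2 + (Im c)\<^sup>2) * (norm x)\<^sup>2"
    by (simp add: cscale_def power2_norm_eq_inner inner_add_left inner_add_right JJ(1)
        inner_commute[of "J x" x] algebra_simps power2_eq_square[of "Re c"] power2_eq_square[of "Im c"])
  also have "\<dots> = (cmod c * norm x)\<^sup>2"
    by (simp add: cmod_def power_mult_distrib)
  finally show ?thesis by simp
qed

lemma bounded_bilinear_cscale: "bounded_bilinear (cscale J)"
proof
  have lin: "linear J" using J by (simp add: complex_structure_def)
  show "cscale J (a + a') b = cscale J a b + cscale J a' b" for a a' b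
    by (simp add: cscale_def algebra_simps)
  show "cscale J a (b + b') = cscale J a b + cscale J a b'" for a b b'
    by (simp add: cscale_def linear_add[OF lin] algebra_simps)
  show "cscale J (r *\<^sub>R a) b = r *\<^sub>R cscale J a b" for r a b
    by (simp add: cscale_def algebra_simps)
  show "cscale J a (r *\<^sub>R b) = r *\<^sub>R cscale J a b" for r a b
    by (simp add: cscale_def linear_scale[OF lin] algebra_simps)
  show "\<exists>K. \<forall>a b. norm (cscale J a b) \<le> norm a * norm b * K"
    by (rule exI[of _ 1]) (simp add: norm_cscale)
qed

lemma cscale_mult: "cscale J (c * d) x = cscale J c (cscale J d x)"
proof -
  have "linear J" "J (J x) = - x" using J by (auto simp: complex_structure_def)
  then show ?thesis by (simp add: cscale_def linear_add linear_scale algebra_simps)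
qed

lemma cscale_of_real: "cscale J (of_real t) x = t *\<^sub>R x"
  by (simp add: cscale_def)

text \<open>Meant for \<open>b n = (- A)^n g\<close> with \<open>A\<close> bounded by
  \<open>r\<close> along these vectors: comparison with the scalar exponential series yields the
  growth rate that bounds the type.\<close>

lemma exponential_series_bound:
  assumes "\<And>n. norm (b n) \<le> C * r ^ n"
  shows "summable (\<lambda>n. cscale J (z ^ n / fact n) (b n))"
    "norm (\<Sum>n. cscale J (z ^ n / fact n) (b n)) \<le> C * exp (r * cmod z)"
proof -
  have le: "norm (cscale J (z ^ n / fact n) (b n)) \<le> C * ((r * cmod z) ^ n / fact n)" for n
    using mult_left_mono[OF assms[of n], of "cmod z ^ n / fact n"]
    by (simp add: norm_cscale norm_divide norm_power power_mult_distrib mult_ac)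
  have "(\<lambda>n. C * ((r * cmod z) ^ n / fact n)) sums (C * exp (r * cmod z))"
    using exp_converges[of "r * cmod z"] by (intro sums_mult) (simp add: divide_inverse_commute scaleR_conv_of_real)
  then show "summable (\<lambda>n. cscale J (z ^ n / fact n) (b n))"
    "norm (\<Sum>n. cscale J (z ^ n / fact n) (b n)) \<le> C * exp (r * cmod z)"
    using hilbert_summable_norm_suminf_le[of "\<lambda>n. cscale J (z ^ n / fact n) (b n)", OF le]
    by (simp_all only: sums_iff)
qed

text \<open>Termwise differentiation shifts the coefficients, which for
  \<open>b n = (- A)^n g\<close> is the differential equation. The differentiated series converges
  uniformly on bounded sets, hence the ball of radius \<open>cmod z + 1\<close>.\<close>

lemma exponential_series_has_derivative:
  assumes b: "\<And>n. norm (b n) \<le> C * r ^ n" and r: "r \<ge> 0"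
  shows "((\<lambda>z. \<Sum>n. cscale J (z ^ n / fact n) (b n)) has_derivative
    (\<lambda>h. cscale J h (\<Sum>n. cscale J (z ^ n / fact n) (b (Suc n))))) (at z)"
proof -
  interpret bounded_bilinear "cscale J" by (rule bounded_bilinear_cscale)
  define F where "F = (\<lambda>z. \<Sum>n. cscale J (z ^ n / fact n) (b n))"
  define G where "G = (\<lambda>z. \<Sum>n. cscale J (z ^ n / fact n) (b (Suc n)))"
  define f' where "f' = (\<lambda>n (z::complex) h. cscale J (of_nat n * z ^ (n - 1) / fact n * h) (b n))"
  define R where "R = cmod z + 1"
  have z: "z \<in> ball 0 R" and R: "R \<ge> 0" by (simp_all add: R_def)
  have b': "norm (b (Suc n)) \<le> (C * r) * r ^ n" for n using b[of "Suc n"] by (simp add: mult_ac)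
  have C: "0 \<le> C" using order.trans[OF norm_ge_zero b[of 0]] by simp
  have "\<exists>g. \<forall>x\<in>ball 0 R. (\<lambda>n. cscale J (x ^ n / fact n) (b n)) sums g x \<and>
      (g has_derivative (\<lambda>h. cscale J h (G x))) (at x within ball 0 R)"
  proof (rule hilbert_has_derivative_series[where f' = f', OF convex_ball _ _ z summable_sums[OF exponential_series_bound(1)[OF b]]])
    show "((\<lambda>x. cscale J (x ^ n / fact n) (b n)) has_derivative f' n x) (at x within ball 0 R)" for n x
    proof -
      have "((\<lambda>x::complex. x ^ n / fact n) has_derivative (\<lambda>h. of_nat n * x ^ (n - 1) / fact n * h)) (at x within ball 0 R)"
        by (rule has_field_derivative_imp_has_derivative) (auto intro!: derivative_eq_intros)
      then show ?thesis
        unfolding f'_def by (rule bounded_linear.has_derivative[OF bounded_linear_left])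
    qed
    fix e :: real assume e: "e > 0"
    define c where "c = (\<lambda>n. (C * r) * ((r * R) ^ n / fact n))"
    have c: "summable c"
      unfolding c_def using summable_exp[of "r * R"] by (intro summable_mult) (simp add: divide_inverse_commute)
    obtain N where N: "\<And>n. n \<ge> N \<Longrightarrow> norm (\<Sum>i. c (i + n)) < e"
      using suminf_exist_split[OF e c] by blast
    show "\<forall>\<^sub>F n in sequentially. \<forall>x\<in>ball 0 R. \<forall>h. norm ((\<Sum>i<n. f' i x h) - cscale J h (G x)) \<le> e * norm h"
    \<comment> \<open>The constant term has derivative zero, so \<open>n\<close> terms of the
      differentiated series are \<open>n - 1\<close> terms of the shifted one; hence the threshold
      \<open>Suc N\<close>.\<close>
    proof (rule eventually_sequentiallyI[of "Suc N"], intro ballI allI)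
      fix n and x h :: complex assume n: "Suc N \<le> n" and x: "x \<in> ball 0 R"
      then obtain m where m: "n = Suc m" "m \<ge> N" by (metis Suc_le_D Suc_le_mono)
      define u where "u = (\<lambda>i. cscale J (x ^ i / fact i) (b (Suc i)))"
      have su: "summable u" unfolding u_def by (rule exponential_series_bound(1)[OF b'])
      have uc: "norm (u i) \<le> c i" for i
      proof -
        have "norm (u i) \<le> cmod x ^ i / fact i * (C * r * r ^ i)"
          using mult_left_mono[OF b'[of i], of "cmod x ^ i / fact i"]
          by (simp add: u_def norm_cscale norm_divide norm_power)
        also have "\<dots> \<le> R ^ i / fact i * (C * r * r ^ i)"
          using x C r by (intro mult_right_mono divide_right_mono power_mono) auto
        finally show ?thesis by (simp add: c_def power_mult_distrib mult_ac)
      qed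
      have "(\<Sum>i<n. f' i x h) = (\<Sum>i<m. f' (Suc i) x h)"
        unfolding m by (subst sum.lessThan_Suc_shift) (simp add: f'_def zero_left)
      also have "\<dots> = (\<Sum>i<m. cscale J h (u i))"
      proof (rule sum.cong)
        fix i
        have "of_nat (Suc i) * x ^ (Suc i - 1) / fact (Suc i) * h = h * (x ^ i / fact i)"
          by (simp del: of_nat_Suc)
        then show "f' (Suc i) x h = cscale J h (u i)"
          unfolding f'_def u_def by (simp only: cscale_mult)
      qed simp
      also have "\<dots> - cscale J h (G x) = - cscale J h (suminf u - (\<Sum>i<m. u i))"
        by (simp add: G_def u_def sum_right diff_right)
      also have "norm \<dots> = cmod h * norm (\<Sum>i. u (i + m))"
        by (simp add: norm_cscale suminf_minus_initial_segment[OF su])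
      also have "\<dots> \<le> cmod h * e"
      proof (rule mult_left_mono)
        have "norm (\<Sum>i. u (i + m)) \<le> (\<Sum>i. c (i + m))"
          using uc c by (intro hilbert_summable_norm_suminf_le(2)) (auto simp: summable_iff_shift)
        then show "norm (\<Sum>i. u (i + m)) \<le> e" using N[OF m(2)] by simp
      qed simp
      finally show "norm ((\<Sum>i<n. f' i x h) - cscale J h (G x)) \<le> e * norm h"
        by (simp only: mult.commute)
    qed
  qed
  then obtain g where g: "\<And>x. x \<in> ball 0 R \<Longrightarrow> (\<lambda>n. cscale J (x ^ n / fact n) (b n)) sums g x"
    "\<And>x. x \<in> ball 0 R \<Longrightarrow> (g has_derivative (\<lambda>h. cscale J h (G x))) (at x within ball 0 R)" by blast
  have "g x = F x" if "x \<in> ball 0 R" for x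
    using g(1)[OF that] by (simp add: F_def sums_iff)
  then have "(F has_derivative (\<lambda>h. cscale J h (G z))) (at z within ball 0 R)"
    using has_derivative_transform[OF z _ g(2)[OF z]] by simp
  then show ?thesis using at_within_open[OF z open_ball] by (simp add: F_def G_def)
qed

end

lemma (in nonneg_operator) exponential_in_S0_type_le:
  assumes J: "complex_structure J" and r: "r > 0"
    and P: "bounded_linear P" and PP: "\<And>x. P (P x) = P x" and PD: "\<And>x. P x \<in> D"
    and PA: "\<And>x. P (A (P x)) = A (P x)" and nA: "\<And>x. norm (A (P x)) \<le> r * norm (P x)"
  obtains y where "y \<in> S0_type_le J D A r" "y 0 = P g"
proof -
  \<comment> \<open>An everywhere defined bounded operator agreeing with \<open>A\<close> on the
    range of \<open>P\<close>; it passes through sums and integrals without domain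
    conditions.\<close>
  define a where "a = (\<lambda>x. A (P x))"
  note lin = linear_0 linear_add linear_diff linear_scale
  note PL = lin[OF bounded_linear.linear[OF P]]
  define b where "b = rec_nat (P g) (\<lambda>n x. - a x)"
  have b0: "b 0 = P g" and bS: "\<And>n. b (Suc n) = - a (b n)" by (simp_all add: b_def)
  have Pb: "P (b n) = b n" for n
  proof (induction n)
    case (Suc n)
    then show ?case
      using PA[of "b n"] by (simp add: bS a_def linear_neg[OF bounded_linear.linear[OF P]])
  qed (simp add: b0 PP)
  define C where "C = norm (P g)"
  have nb: "norm (b n) \<le> C * r ^ n" for n
  proof (induction n)
    case (Suc n)
    have "norm (b (Suc n)) \<le> r * norm (b n)" using nA[of "b n"] by (simp add: bS a_def Pb)
    also have "\<dots> \<le> r * (C * r ^ n)" using Suc r by simp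
    finally show ?case by (simp add: mult_ac)
  qed (simp add: b0 C_def)
  obtain K where K: "\<And>x. norm (P x) \<le> norm x * K" using bounded_linear.bounded[OF P] by blast
  have La: "bounded_linear a"
  proof (rule bounded_linear_intro)
    show "a (x + y) = a x + a y" "a (c *\<^sub>R x) = c *\<^sub>R a x" for x y c
      by (simp_all add: a_def PL A_add A_scale PD)
    show "norm (a x) \<le> norm x * (r * K)" for x
      using order.trans[OF nA[of x] mult_left_mono[OF K[of x], of r]] r by (simp add: a_def mult_ac)
  qed
  define F where "F = (\<lambda>z. \<Sum>n. cscale J (z ^ n / fact n) (b n))"
  define G where "G = (\<lambda>z. \<Sum>n. cscale J (z ^ n / fact n) (b (Suc n)))"
  have nb': "norm (b (Suc n)) \<le> (C * r) * r ^ n" for n using nb[of "Suc n"] by (simp add: mult_ac)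
  have F': "(F has_derivative (\<lambda>h. cscale J h (G z))) (at z)" for z
    unfolding F_def G_def using exponential_series_has_derivative[OF J nb] r by simp
  define y where "y = (\<lambda>t. F (complex_of_real t))"
  have y_sum: "summable (\<lambda>n. (t ^ n / fact n) *\<^sub>R b n)" "y t = (\<Sum>n. (t ^ n / fact n) *\<^sub>R b n)"
    and G_sum: "G (of_real t) = (\<Sum>n. (t ^ n / fact n) *\<^sub>R b (Suc n))" for t
  proof -
    have "cscale J (of_real t ^ n / fact n) x = (t ^ n / fact n) *\<^sub>R x" for n x
      using cscale_of_real[of J "t ^ n / fact n" x] J by (simp add: cscale_of_real)
    then show "summable (\<lambda>n. (t ^ n / fact n) *\<^sub>R b n)" "y t = (\<Sum>n. (t ^ n / fact n) *\<^sub>R b n)"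
      "G (of_real t) = (\<Sum>n. (t ^ n / fact n) *\<^sub>R b (Suc n))"
      using exponential_series_bound(1)[OF J nb, of "of_real t"] by (simp_all add: y_def F_def G_def)
  qed
  have ay: "G (of_real t) = - a (y t)" for t
  proof -
    have "G (of_real t) = (\<Sum>n. - a ((t ^ n / fact n) *\<^sub>R b n))"
      by (simp add: G_sum bS linear_scale[OF bounded_linear.linear[OF La]])
    also have "\<dots> = - (\<Sum>n. a ((t ^ n / fact n) *\<^sub>R b n))"
      by (rule suminf_minus[OF bounded_linear.summable[OF La y_sum(1)]])
    also have "(\<Sum>n. a ((t ^ n / fact n) *\<^sub>R b n)) = a (y t)"
      unfolding y_sum(2) by (rule bounded_linear.suminf[OF La y_sum(1), symmetric])
    finally show ?thesis .
  qed
  have Py: "P (y t) = y t" for t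
    unfolding y_sum(2) bounded_linear.suminf[OF P y_sum(1)] by (simp add: PL Pb)
  have y': "(y has_vector_derivative (- a (y t))) (at t within S)" for t S
  proof -
    have "((\<lambda>t. complex_of_real t) has_derivative complex_of_real) (at t within S)"
      by (intro bounded_linear_imp_has_derivative bounded_linear_of_real)
    from has_derivative_compose[OF this F'] show ?thesis
      using J by (simp add: has_vector_derivative_def y_def cscale_of_real ay[unfolded y_def])
  qed
  have cy: "continuous_on S y" for S
    by (rule continuous_on_vector_derivative) (rule y')
  have iy: "y integrable_on {0..t}" for t by (rule hilbert_integrable_continuous[OF cy])
  have "y \<in> weak_solutions D A"
  proof (rule weak_solutionI[OF cy])
    fix t :: real assume t: "t \<ge> 0"
    have PI: "P (integral {0..t} y) = integral {0..t} y"
      using integral_linear[OF iy P, symmetric] by (simp add: o_def Py)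
    show "integral {0..t} y \<in> D" using PD[of "integral {0..t} y"] by (simp add: PI)
    have "A (integral {0..t} y) = integral {0..t} (\<lambda>s. a (y s))"
      using integral_linear[OF iy La, of t] by (simp add: o_def a_def PI)
    also have "\<dots> = - integral {0..t} (\<lambda>s. - a (y s))" by simp
    also have "\<dots> = - (y t - y 0)"
      using integral_unique[OF hilbert_fundamental_theorem_of_calculus[OF t y']] by simp
    finally show "A (integral {0..t} y) = y 0 - y t" by simp
  qed
  moreover have "entire_fun J F" unfolding entire_fun_def using F' by blast
  moreover have "r \<in> type_exponents F"
    unfolding type_exponents_def F_def using exponential_series_bound(2)[OF J nb] r by blast
  moreover from this have "Inf (type_exponents F) \<le> r"
    by (rule cInf_lower) (auto simp: type_exponents_def intro!: bdd_belowI[of _ 0])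
  ultimately have "y \<in> S0_type_le J D A r"
    unfolding S0_type_le_def y_def by blast
  moreover have "y 0 = P g"
    unfolding y_sum(2) by (subst suminf_finite[of "{0}"]) (auto simp: b0)
  ultimately show thesis by (rule that)
qed

section \<open>Best approximation\<close>

text \<open>Pascal's rule, in the form \<open>(T - 1)^(k + 1) = (T - 1)^k (T - 1)\<close> for the
  shift \<open>T\<close>; it drives the induction on the order of the difference.\<close>

lemma alternating_binomial_sum_Suc:
  fixes f :: "nat \<Rightarrow> 'a::real_vector"
  shows "(\<Sum>j=0..Suc k. ((-1) ^ (Suc k - j) * real (Suc k choose j)) *\<^sub>R f j)
    = (\<Sum>j=0..k. ((-1) ^ (k - j) * real (k choose j)) *\<^sub>R (f (Suc j) - f j))"
proof -
  let ?c = "\<lambda>k j. (-1) ^ (k - j) * real (k choose j)"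
  have pascal: "?c (Suc k) (Suc j) = ?c k j - ?c k (Suc j)" for j
  proof (cases "j < k")
    case True
    then have "k - j = Suc (k - Suc j)" by simp
    then show ?thesis by (simp add: algebra_simps)
  qed (cases "j = k"; simp)
  have "(\<Sum>j=0..Suc k. ?c (Suc k) j *\<^sub>R f j)
      = ?c (Suc k) 0 *\<^sub>R f 0 + (\<Sum>j=0..k. ?c (Suc k) (Suc j) *\<^sub>R f (Suc j))"
    by (simp only: sum.atLeast0_atMost_Suc_shift o_def)
  also have "(\<Sum>j=0..k. ?c (Suc k) (Suc j) *\<^sub>R f (Suc j))
      = (\<Sum>j=0..k. ?c k j *\<^sub>R f (Suc j)) - (\<Sum>j=0..k. ?c k (Suc j) *\<^sub>R f (Suc j))"
    unfolding pascal by (simp only: scaleR_diff_left sum_subtractf)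
  also have "(\<Sum>j=0..k. ?c k (Suc j) *\<^sub>R f (Suc j)) = (\<Sum>j=0..k. ?c k j *\<^sub>R f j) - ?c k 0 *\<^sub>R f 0"
  proof -
    \<comment> \<open>The upper limit may be raised to \<open>Suc k\<close> at no cost, because
      \<open>k choose Suc k\<close> is zero.\<close>
    have split: "(\<Sum>j=0..Suc k. ?c k j *\<^sub>R f j) = ?c k 0 *\<^sub>R f 0 + (\<Sum>j=0..k. ?c k (Suc j) *\<^sub>R f (Suc j))"
      by (simp only: sum.atLeast0_atMost_Suc_shift o_def)
    have "(\<Sum>j=0..k. ?c k j *\<^sub>R f j) = (\<Sum>j=0..Suc k. ?c k j *\<^sub>R f j)"
      by simp
    then show ?thesis by (simp only: split add_diff_cancel_left')
  qed
  finally show ?thesis by (simp add: scaleR_diff_right sum_subtractf)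
qed

context nonneg_operator
begin

text \<open>Induction over all solutions annihilated by \<open>P\<close>, a class that contains the
  first difference \<open>w\<close> along with \<open>v\<close>. The reverse triangle inequality
  turns decay of \<open>v\<close> over one step into a lower bound for \<open>w 0\<close>.\<close>

lemma spectral_gap_difference_bound:
  assumes P: "bounded_linear P" and r: "r > 0"
    and gap: "\<And>x. \<lbrakk>x \<in> D; P x = 0\<rbrakk> \<Longrightarrow> r * (norm x)\<^sup>2 \<le> inner (A x) x"
    and v: "v \<in> weak_solutions D A" "\<And>t. t \<ge> 0 \<Longrightarrow> P (v t) = 0"
  shows "(1 - exp (-1)) ^ k * norm (v 0)
    \<le> norm (\<Sum>j=0..k. ((-1) ^ (k - j) * real (k choose j)) *\<^sub>R v (real j * (1 / r)))"
  using v
proof (induction k arbitrary: v)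
  case (Suc k)
  define h where "h = 1 / r"
  define w where "w = (\<lambda>t. v (t + h) - v t)"
  have h: "h > 0" "r * h = 1" using r by (simp_all add: h_def)
  have "w \<in> weak_solutions D A"
    unfolding w_def using h Suc.prems by (intro weak_solution_diff weak_solution_shift) auto
  moreover have "P (w t) = 0" if "t \<ge> 0" for t
    using Suc.prems(2)[of t] Suc.prems(2)[of "t + h"] h that
    by (simp add: w_def linear_diff bounded_linear.linear[OF P])
  ultimately have IH: "(1 - exp (-1)) ^ k * norm (w 0)
      \<le> norm (\<Sum>j=0..k. ((-1) ^ (k - j) * real (k choose j)) *\<^sub>R w (real j * h))"
    unfolding h_def by (rule Suc.IH)
  have "norm (v h) \<le> exp (- 1) * norm (v 0)"
  proof -
    have "norm (v h) \<le> exp (- (r * h)) * norm (v 0)"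
      using h by (intro weak_solution_spectral_gap[where P = P] Suc.prems P gap) auto
    then show ?thesis by (simp only: h)
  qed
  then have "(1 - exp (-1)) * norm (v 0) \<le> norm (w 0)"
    using norm_triangle_ineq2[of "v 0" "v h"] by (simp add: w_def norm_minus_commute algebra_simps)
  then have "(1 - exp (-1)) ^ k * ((1 - exp (-1)) * norm (v 0)) \<le> (1 - exp (-1)) ^ k * norm (w 0)"
    by (intro mult_left_mono) auto
  also note IH
  also have "(\<Sum>j=0..k. ((-1) ^ (k - j) * real (k choose j)) *\<^sub>R w (real j * h))
      = (\<Sum>j=0..Suc k. ((-1) ^ (Suc k - j) * real (Suc k choose j)) *\<^sub>R v (real j * h))"
    unfolding alternating_binomial_sum_Suc w_def by (simp add: algebra_simps)
  finally show ?case by (simp only: h_def power_Suc2 mult.assoc)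
qed simp

lemma norm_difference_le_modulus:
  assumes y: "y \<in> weak_solutions D A" and h: "h \<ge> 0"
  shows "norm (\<Sum>j=0..k. ((-1) ^ (k - j) * real (k choose j)) *\<^sub>R y (real j * h)) \<le> modulus k h y"
proof -
  define d where "d = (\<lambda>h s. norm (\<Sum>j=0..k. ((-1) ^ (k - j) * real (k choose j)) *\<^sub>R y (s + real j * h)))"
  \<comment> \<open>A bound uniform in step and base point, which makes both nested suprema genuine
    upper bounds.\<close>
  define K where "K = (\<Sum>j=0..k. real (k choose j) * norm (y 0))"
  have dK: "d u s \<le> K" if "u \<ge> 0" "s \<ge> 0" for u s
    unfolding d_def K_def
    by (rule order.trans[OF norm_sum sum_mono])
      (use that in \<open>simp add: abs_mult mult_left_mono weak_solution_norm_le[OF y]\<close>)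
  have bdd: "bdd_above (d u ` {0..})" if "u \<ge> 0" for u
    using dK[OF that] by (intro bdd_aboveI[of _ K]) auto
  have "(SUP s\<in>{0..}. d u s) \<le> K" if "u \<ge> 0" for u
    using dK[OF that] by (intro cSUP_least) auto
  then have "bdd_above ((\<lambda>u. SUP s\<in>{0..}. d u s) ` {0..h})"
    by (intro bdd_aboveI[of _ K]) auto
  then have "(SUP s\<in>{0..}. d h s) \<le> (SUP u\<in>{0..h}. SUP s\<in>{0..}. d u s)"
    using h by (intro cSUP_upper) auto
  also have "\<dots> = modulus k h y" by (simp add: modulus_def d_def)
  finally have "(SUP s\<in>{0..}. d h s) \<le> modulus k h y" .
  moreover have "d h 0 \<le> (SUP s\<in>{0..}. d h s)" using bdd[OF h] by (intro cSUP_upper) auto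
  ultimately show ?thesis by (simp add: d_def)
qed

lemma S_norm_weak_solution:
  assumes "v \<in> weak_solutions D A"
  shows "S_norm v = norm (v 0)"
  unfolding S_norm_def
  by (rule cSup_eq_maximum) (use weak_solution_norm_le[OF assms] in auto)

lemma best_approx_le:
  assumes "y \<in> weak_solutions D A" "y\<^sub>0 \<in> S0_type_le J D A r"
  shows "best_approx J D A r y \<le> norm (y 0 - y\<^sub>0 0)"
proof -
  \<comment> \<open>Identifying the competing errors with norms of initial values shows that they
    are nonnegative, so the infimum is bounded below.\<close>
  have "S_norm (\<lambda>t. y t - z t) = norm (y 0 - z 0)" if "z \<in> S0_type_le J D A r" for z
    using that assms(1) by (intro S_norm_weak_solution weak_solution_diff) (auto simp: S0_type_le_def)
  then show ?thesis
    unfolding best_approx_def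
    by (intro cINF_lower2[OF _ assms(2)] bdd_belowI[of _ 0]) (auto simp: assms(2))
qed

end

theorem theorem2:
  fixes J :: "'a::{real_inner,complete_space} \<Rightarrow> 'a"
    and D :: "'a set" and A :: "'a \<Rightarrow> 'a"
    and y :: "real \<Rightarrow> 'a" and k :: nat
  assumes "complex_structure J"
    and "nonneg_self_adjoint J D A"
    and "y \<in> weak_solutions D A"
    and "k \<ge> 1"
  shows "\<exists>c>0. \<forall>r>0. best_approx J D A r y \<le> c * modulus k (1 / r) y"
proof -
  interpret nonneg_operator D A
    using assms(1,2) by (rule nonneg_self_adjoint_imp_nonneg_operator)
  define q where "q = (1 - exp (-1 :: real)) ^ k"
  have q: "q > 0" by (simp add: q_def)
  show ?thesis
  proof (intro exI[of _ "1 / q"] conjI allI impI)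
    fix r :: real assume r: "r > 0"
    obtain P where P: "bounded_linear P" "\<And>x. P (P x) = P x"
      and "\<And>x. norm (P x) \<le> norm x"
      and norm_diff: "\<And>x. norm (x - P x) \<le> norm x"
      and PD: "\<And>x. P x \<in> D" "\<And>x. P (A (P x)) = A (P x)" "\<And>x. norm (A (P x)) \<le> r * norm (P x)"
      and comm: "\<And>x. x \<in> D \<Longrightarrow> A (P x) = P (A x)"
      and gap: "\<And>x. \<lbrakk>x \<in> D; P x = 0\<rbrakk> \<Longrightarrow> r * (norm x)\<^sup>2 \<le> inner (A x) x"
      by (rule spectral_cutoff[OF r], rule that)
    note lin = bounded_linear.linear[OF P(1)]
    obtain y\<^sub>0 where y0: "y\<^sub>0 \<in> S0_type_le J D A r" "y\<^sub>0 0 = P (y 0)"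
      by (rule exponential_in_S0_type_le[where P = P and g = "y 0", OF assms(1) r P PD], rule that)
    define v where "v = (\<lambda>t. y t - P (y t))"
    have v: "v \<in> weak_solutions D A"
      unfolding v_def by (intro weak_solution_diff weak_solution_commute[where P = P] assms(3) P(1) PD(1) comm)
    have Pv: "P (v t) = 0" for t by (simp add: v_def linear_diff[OF lin] P(2))
    let ?\<Delta> = "\<lambda>z. \<Sum>j=0..k. ((-1) ^ (k - j) * real (k choose j)) *\<^sub>R z (real j * (1 / r))"
    have "best_approx J D A r y \<le> norm (v 0)"
      using best_approx_le[OF assms(3) y0(1)] by (simp add: v_def y0(2))
    then have "q * best_approx J D A r y \<le> q * norm (v 0)" using q by simp
    also have "\<dots> \<le> norm (?\<Delta> v)"
      unfolding q_def by (rule spectral_gap_difference_bound[where P = P, OF P(1) r gap v Pv])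
    \<comment> \<open>Differences pass through the linear map \<open>P\<close>; since
      \<open>1 - P\<close> is a contraction, \<open>v\<close> can then be replaced by
      \<open>y\<close> without loss.\<close>
    also have "?\<Delta> v = ?\<Delta> y - P (?\<Delta> y)"
      by (simp add: v_def linear_sum[OF lin] linear_scale[OF lin] scaleR_diff_right sum_subtractf)
    also have "norm \<dots> \<le> norm (?\<Delta> y)" by (rule norm_diff)
    also have "\<dots> \<le> modulus k (1 / r) y"
      using r by (intro norm_difference_le_modulus assms(3)) simp
    finally show "best_approx J D A r y \<le> 1 / q * modulus k (1 / r) y"
      using q by (simp add: field_simps)
  qed (use q in simp)
qed

end
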